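(* Let $\varphi:[0,\infty)\to[0,\infty)$ be a metric transform and let $(X,d_X)$ be a $\mathrm{CAT}(0)$ space. Then the metric space $(X,\varphi\circ d_X)$ embeds into some $\mathrm{CAT}(0)$ space with distortion at most $\pi\sqrt{3/2}$ (in particular, less than $4$).
   Context: A metric transform is a function $\varphi:[0,\infty)\to[0,\infty)$ that is nondecreasing, concave, and satisfies $\varphi(0)=0$; then $\varphi\circ d_X$ is again a metric. A metric space $(X,d)$ is $\mathrm{CAT}(0)$ if every two points are joined by a geodesic, and for all $x,y,z\in X$, every constant-speed geodesic $\phi:[0,1]\to X$ with $\phi(0)=y$, $\phi(1)=z$ and every $t\in[0,1]$: $d(x,\phi(t))^2\le (1-t)d(x,y)^2+t\,d(x,z)^2-t(1-t)d(y,z)^2$. An embedding $f:(X,d_X)\to(Y,d_Y)$ has distortion at most $D$ if there is $s>0$ with $d_X(x,y)\le s\,d_Y(f(x),f(y))\le D\,d_X(x,y)$ for all $x,y\in X$. *)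

theory Defs
  imports "HOL-Analysis.Analysis"
begin

text \<open>Only the restriction of the function to the nonnegative reals is meaningful.\<close>

definition metric_transform :: "(real \<Rightarrow> real) \<Rightarrow> bool" where
  "metric_transform \<phi> \<longleftrightarrow>
     \<phi> \<in> {0..} \<rightarrow> {0..} \<and> mono_on {0..} \<phi> \<and> concave_on {0..} \<phi> \<and> \<phi> 0 = 0"

definition const_speed_geodesic ::
    "'a set \<Rightarrow> ('a \<Rightarrow> 'a \<Rightarrow> real) \<Rightarrow> (real \<Rightarrow> 'a) \<Rightarrow> 'a \<Rightarrow> 'a \<Rightarrow> bool" where
  "const_speed_geodesic X d g y z \<longleftrightarrow>
     g \<in> {0..1} \<rightarrow> X \<and> g 0 = y \<and> g 1 = z \<and>
     (\<forall>s\<in>{0..1}. \<forall>t\<in>{0..1}. d (g s) (g t) = \<bar>s - t\<bar> * d y z)"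

text \<open>Completeness is not part of the definition.\<close>

definition CAT0 :: "'a set \<Rightarrow> ('a \<Rightarrow> 'a \<Rightarrow> real) \<Rightarrow> bool" where
  "CAT0 X d \<longleftrightarrow>
     Metric_space X d \<and>
     (\<forall>y\<in>X. \<forall>z\<in>X. \<exists>g. const_speed_geodesic X d g y z) \<and>
     (\<forall>x\<in>X. \<forall>y\<in>X. \<forall>z\<in>X. \<forall>g. const_speed_geodesic X d g y z \<longrightarrow>
        (\<forall>t\<in>{0..1}. (d x (g t))\<^sup>2 \<le>
           (1 - t) * (d x y)\<^sup>2 + t * (d x z)\<^sup>2 - t * (1 - t) * (d y z)\<^sup>2))"

definition embedding_distortion_le ::
    "'a set \<Rightarrow> ('a \<Rightarrow> 'a \<Rightarrow> real) \<Rightarrow> 'b set \<Rightarrow> ('b \<Rightarrow> 'b \<Rightarrow> real) \<Rightarrow> ('a \<Rightarrow> 'b) \<Rightarrow> real \<Rightarrow> bool" where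
  "embedding_distortion_le X dX Y dY f D \<longleftrightarrow>
     f \<in> X \<rightarrow> Y \<and>
     (\<exists>s>0. \<forall>x\<in>X. \<forall>y\<in>X.
        dX x y \<le> s * dY (f x) (f y) \<and> s * dY (f x) (f y) \<le> D * dX x y)"

text \<open>
  HOL cannot quantify existentially over types, so the points of ``some CAT(0) space'' are drawn
  from a fixed type, on which carrier and metric are arbitrary. Nothing is lost: if \<open>X\<close>
  (with points in \<open>'a\<close>) embeds into a CAT(0) space, it also embeds into the geodesically
  convex hull of its image, which is CAT(0) and has cardinality at most
  \<open>\<bar>'a\<bar> \<cdot> \<bar>\<real>\<bar>\<close> (and even the closure of that hull has at most
  \<open>(\<bar>'a\<bar> \<cdot> \<bar>\<real>\<bar>)\<close>-to-the-\<open>\<aleph>\<^sub>0\<close> points).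
\<close>

type_synonym 'a target_point = "nat \<Rightarrow> 'a \<times> real"

definition embeds_into_some_CAT0 ::
    "'a set \<Rightarrow> ('a \<Rightarrow> 'a \<Rightarrow> real) \<Rightarrow> real \<Rightarrow> bool" where
  "embeds_into_some_CAT0 X dX D \<longleftrightarrow>
     (\<exists>(Y :: 'a target_point set) dY f. CAT0 Y dY \<and> embedding_distortion_le X dX Y dY f D)"

end

theory Submission
  imports Defs "HOL-Library.Nat_Bijection"
begin

text \<open>
  Since \<open>\<phi>\<close> is concave, so is \<open>u \<mapsto> \<phi>(sqrt u)\<^sup>2\<close>, and interpolation at the powers of 4 shows that it
  agrees up to a factor 4 with a combination \<open>c * u + j + (\<Sum>n. a n * min u (4 powi n))\<close> with
  nonnegative coefficients (for \<open>u > 0\<close>). Hence it suffices to realise every \<open>min (d x y) R\<close> up to a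
  factor \<open>pi / 2\<close> in a CAT(0) space and to take the \<open>l\<^sup>2\<close> product of these spaces with \<open>X\<close> itself
  (for \<open>c * u\<close>) and a star (for the jump \<open>j\<close> at 0). The truncated distance is realised on a sphere of
  the Euclidean cone over \<open>X\<close> with angles \<open>min (pi / R * d x y) pi\<close>, on which
  distances are proportional to the sine of the half angle. The total distortion is \<open>2 * (pi / 2) = pi\<close>.
\<close>

section \<open>Spaces with a comparison inequality and their products\<close>

text \<open>An l^2 product adds squared distances, so what is decomposed is
  \<open>\<phi>\<^sup>2\<close> as a function of the squared distance \<open>u\<close>. Each
  \<open>min u (4 powi n)\<close> is the square of a truncated distance; truncation destroys
  geodesics, so truncated distances are replaced by chords of a sphere. The sphere sits in a cone
  because a CAT(0) space satisfies the CAT(1) comparison inequality at every scale, and Euclidean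
  cones over such spaces are CAT(0). The factor \<open>pi / 2\<close> is the gap between the bounds
  \<open>2 / pi * x \<le> sin x \<le> x\<close> on \<open>[0, pi / 2]\<close>. All constructions use
  pseudometrics and ask for one comparison point instead of speaking of all geodesics: cone points
  of radius 0 have distance 0, a zero coefficient collapses a factor, and comparison points can be
  chosen coordinatewise in a product. Points at distance 0 are identified once, at the end.\<close>

locale pseudo_CAT0 =
  fixes P :: "'b set" and \<delta> :: "'b \<Rightarrow> 'b \<Rightarrow> real"
  assumes zero: "x \<in> P \<Longrightarrow> \<delta> x x = 0"
    and nonneg: "x \<in> P \<Longrightarrow> y \<in> P \<Longrightarrow> 0 \<le> \<delta> x y"
    and commute: "x \<in> P \<Longrightarrow> y \<in> P \<Longrightarrow> \<delta> x y = \<delta> y x"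
    and triangle: "x \<in> P \<Longrightarrow> y \<in> P \<Longrightarrow> z \<in> P \<Longrightarrow> \<delta> x z \<le> \<delta> x y + \<delta> y z"
    and comparison: "y \<in> P \<Longrightarrow> z \<in> P \<Longrightarrow> 0 \<le> t \<Longrightarrow> t \<le> 1 \<Longrightarrow>
      \<exists>m\<in>P. \<forall>x\<in>P. (\<delta> x m)\<^sup>2 \<le>
        (1 - t) * (\<delta> x y)\<^sup>2 + t * (\<delta> x z)\<^sup>2 - t * (1 - t) * (\<delta> y z)\<^sup>2"

section \<open>Passing between CAT(0) spaces and the comparison inequality\<close>

lemma CAT0_imp_pseudo_CAT0:
  assumes "CAT0 X d"
  shows "pseudo_CAT0 X d"
proof -
  interpret Metric_space X d using assms by (simp add: CAT0_def)
  show ?thesis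
  proof
    show "\<exists>m\<in>X. \<forall>x\<in>X. (d x m)\<^sup>2 \<le> (1 - t) * (d x y)\<^sup>2 + t * (d x z)\<^sup>2 - t * (1 - t) * (d y z)\<^sup>2"
      if yz: "y \<in> X" "z \<in> X" and t: "0 \<le> t" "t \<le> 1" for y z t
    proof -
      obtain g where g: "const_speed_geodesic X d g y z"
        using assms yz unfolding CAT0_def by blast
      have "g t \<in> X" using g t by (auto simp: const_speed_geodesic_def)
      moreover have "(d x (g t))\<^sup>2 \<le> (1 - t) * (d x y)\<^sup>2 + t * (d x z)\<^sup>2 - t * (1 - t) * (d y z)\<^sup>2"
        if "x \<in> X" for x
        using assms g that yz t unfolding CAT0_def by auto
      ultimately show ?thesis by blast
    qed
  next
    show "d x y = d y x" for x y by (rule commute)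
    show "d x z \<le> d x y + d y z" if "x \<in> X" "y \<in> X" "z \<in> X" for x y z
      using that by (rule triangle)
  qed simp_all
qed

text \<open>Testing the comparison inequality against points of the curve itself forces the curve to be
  a geodesic, and against another geodesic forces the two to coincide.\<close>

lemma pseudo_CAT0_imp_CAT0:
  assumes "pseudo_CAT0 Y d" and M: "Metric_space Y d"
  shows "CAT0 Y d"
proof -
  interpret pseudo_CAT0 Y d by fact
  interpret M: Metric_space Y d by fact
  define cmp where "cmp y z t m \<longleftrightarrow> m \<in> Y \<and> (\<forall>x\<in>Y. (d x m)\<^sup>2 \<le>
      (1 - t) * (d x y)\<^sup>2 + t * (d x z)\<^sup>2 - t * (1 - t) * (d y z)\<^sup>2)" for y z t m
  have geod: "\<exists>g. const_speed_geodesic Y d g y z \<and> (\<forall>t\<in>{0..1}. cmp y z t (g t))"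
    if yz: "y \<in> Y" "z \<in> Y" for y z
  proof -
    have "\<forall>t\<in>{0..1}. \<exists>m. cmp y z t m"
    proof
      fix t :: real assume "t \<in> {0..1}"
      then show "\<exists>m. cmp y z t m" using comparison[OF yz, of t] unfolding cmp_def Bex_def by simp
    qed
    then obtain g where g: "\<And>t. t \<in> {0..1} \<Longrightarrow> cmp y z t (g t)"
      using bchoice[of "{0..1}" "cmp y z"] by blast
    have gY: "g t \<in> Y" if "t \<in> {0..1}" for t using g[OF that] by (simp add: cmp_def)
    have le: "(d x (g t))\<^sup>2 \<le> (1 - t) * (d x y)\<^sup>2 + t * (d x z)\<^sup>2 - t * (1 - t) * (d y z)\<^sup>2"
      if "t \<in> {0..1}" "x \<in> Y" for x t using g[OF that(1)] that by (simp add: cmp_def)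
    have y: "d y (g t) \<le> t * d y z" if t: "t \<in> {0..1}" for t
    proof -
      have "(d y (g t))\<^sup>2 \<le> (t * d y z)\<^sup>2"
        using le[OF t yz(1)] yz by (simp add: algebra_simps power2_eq_square)
      then show ?thesis using t by (auto intro: power2_le_imp_le)
    qed
    have z: "d (g t) z \<le> (1 - t) * d y z" if t: "t \<in> {0..1}" for t
    proof -
      have "(d z (g t))\<^sup>2 \<le> ((1 - t) * d y z)\<^sup>2"
        using le[OF t yz(2)] yz by (simp add: algebra_simps power2_eq_square M.commute)
      then show ?thesis using t by (auto intro: power2_le_imp_le simp: M.commute)
    qed
    have ends: "g 0 = y" "g 1 = z"
      using y[of 0] z[of 1] gY[of 0] gY[of 1] yz M.zero[of y "g 0"] M.zero[of "g 1" z]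
        M.nonneg[of y "g 0"] M.nonneg[of "g 1" z] by auto
    \<comment> \<open>At the test point \<open>g s\<close>, the bounds on its distances to
      \<open>y\<close> and \<open>z\<close> turn the right-hand side into the square of
      \<open>(s - t) * d y z\<close>.\<close>
    have up: "d (g s) (g t) \<le> \<bar>s - t\<bar> * d y z" if s: "s \<in> {0..1}" and t: "t \<in> {0..1}" for s t
    proof -
      have "(d (g s) y)\<^sup>2 \<le> (s * d y z)\<^sup>2"
        using y[OF s] by (intro power_mono) (auto simp: M.commute)
      moreover have "(d (g s) z)\<^sup>2 \<le> ((1 - s) * d y z)\<^sup>2"
        using z[OF s] by (intro power_mono) auto
      ultimately have "(1 - t) * (d (g s) y)\<^sup>2 + t * (d (g s) z)\<^sup>2 \<le>
          (1 - t) * (s * d y z)\<^sup>2 + t * ((1 - s) * d y z)\<^sup>2"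
        using t by (intro add_mono mult_left_mono) auto
      then have "(d (g s) (g t))\<^sup>2 \<le> (1 - t) * (s * d y z)\<^sup>2 + t * ((1 - s) * d y z)\<^sup>2
          - t * (1 - t) * (d y z)\<^sup>2"
        using le[OF t gY[OF s]] by linarith
      also have "\<dots> = ((s - t) * d y z)\<^sup>2"
        by (simp add: algebra_simps power2_eq_square)
      also have "\<dots> = (\<bar>s - t\<bar> * d y z)\<^sup>2"
        by (simp add: power_mult_distrib)
      finally show ?thesis by (auto intro: power2_le_imp_le)
    qed
    have low: "(t - s) * d y z \<le> d (g s) (g t)"
      if s: "s \<in> {0..1}" and t: "t \<in> {0..1}" for s t
    proof -
      have "d y z \<le> d y (g s) + d (g s) (g t) + d (g t) z"
        using M.triangle[of y "g s" z] M.triangle[of "g s" "g t" z] yz gY s t by fastforce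
      then show ?thesis using y[OF s] z[OF t] by (simp add: algebra_simps)
    qed
    have "d (g s) (g t) = \<bar>s - t\<bar> * d y z" if s: "s \<in> {0..1}" and t: "t \<in> {0..1}" for s t
      using up[OF s t] low[OF s t] low[OF t s] M.commute[of "g s" "g t"]
      by (intro antisym) (auto simp: abs_if)
    then have "const_speed_geodesic Y d g y z"
      unfolding const_speed_geodesic_def using ends gY by blast
    then show ?thesis using g by blast
  qed
  have "(d x (g t))\<^sup>2 \<le> (1 - t) * (d x y)\<^sup>2 + t * (d x z)\<^sup>2 - t * (1 - t) * (d y z)\<^sup>2"
    if xyz: "x \<in> Y" "y \<in> Y" "z \<in> Y" and g: "const_speed_geodesic Y d g y z" and t: "t \<in> {0..1}"
    for x y z g t
  proof -
    obtain h where h: "cmp y z t (h t)"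
      using geod[OF xyz(2,3)] t by blast
    have gt: "g t \<in> Y" "d (g t) y = t * d y z" "d (g t) z = (1 - t) * d y z"
    proof -
      have sp: "\<forall>s\<in>{0..1}. \<forall>t\<in>{0..1}. d (g s) (g t) = \<bar>s - t\<bar> * d y z" and ge: "g 0 = y" "g 1 = z"
        and "g \<in> {0..1} \<rightarrow> Y"
        using g by (auto simp: const_speed_geodesic_def)
      then show "g t \<in> Y" using t by blast
      show "d (g t) y = t * d y z" using sp[rule_format, of t 0] t ge by simp
      show "d (g t) z = (1 - t) * d y z" using sp[rule_format, of t 1] t ge by simp
    qed
    have "(d (g t) (h t))\<^sup>2 \<le> (1 - t) * (t * d y z)\<^sup>2 + t * ((1 - t) * d y z)\<^sup>2
          - t * (1 - t) * (d y z)\<^sup>2"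
      using h gt by (auto simp: cmp_def)
    also have "\<dots> = 0" by (simp add: algebra_simps power2_eq_square)
    finally have "g t = h t"
      using gt(1) h by (auto simp: cmp_def)
    then show ?thesis using h xyz by (auto simp: cmp_def)
  qed
  then show ?thesis
    unfolding CAT0_def using M geod by blast
qed

text \<open>Representatives chosen inside \<open>P\<close> take the place of equivalence classes, so
  the quotient keeps the point type \<open>'b\<close>; the final space has to live in a prescribed
  type.\<close>

lemma (in pseudo_CAT0) CAT0_quotient:
  obtains Y :: "'b set" and d rep where "CAT0 Y d" "rep \<in> P \<rightarrow> Y"
    "\<And>x y. x \<in> P \<Longrightarrow> y \<in> P \<Longrightarrow> d (rep x) (rep y) = \<delta> x y"
proof -
  define rep where "rep x = (SOME y. y \<in> P \<and> \<delta> x y = 0)" for x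
  have rep: "rep x \<in> P" "\<delta> x (rep x) = 0" if "x \<in> P" for x
    using someI[of "\<lambda>y. y \<in> P \<and> \<delta> x y = 0" x] zero that by (auto simp: rep_def)
  have inv: "\<delta> x z = \<delta> y z" if "x \<in> P" "y \<in> P" "z \<in> P" "\<delta> x y = 0" for x y z
    using triangle[of x y z] triangle[of y x z] commute[of x y] that by auto
  have same: "rep x = rep y" if "x \<in> P" "y \<in> P" "\<delta> x y = 0" for x y
  proof -
    have "(z \<in> P \<and> \<delta> x z = 0) = (z \<in> P \<and> \<delta> y z = 0)" for z
      using inv[of x y z] that by auto
    then show ?thesis unfolding rep_def by simp
  qed
  have rep2: "\<delta> (rep x) (rep y) = \<delta> x y" if "x \<in> P" "y \<in> P" for x y
    using inv[of x "rep x" "rep y"] inv[of y "rep y" x] rep that commute by auto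
  define d where "d x y = (if x \<in> P \<and> y \<in> P then \<delta> x y else 0)" for x y
  have sub: "rep ` P \<subseteq> P" using rep by auto
  have "Metric_space (rep ` P) d"
  proof
    show "d x y = 0 \<longleftrightarrow> x = y" if "x \<in> rep ` P" "y \<in> rep ` P" for x y
    proof -
      obtain u v where uv: "u \<in> P" "v \<in> P" "x = rep u" "y = rep v"
        using \<open>x \<in> rep ` P\<close> \<open>y \<in> rep ` P\<close> by blast
      then have "d x y = \<delta> u v" using rep(1) rep2 by (simp add: d_def)
      then show ?thesis
        using uv same[of u v] zero[of "rep u"] rep(1)[of u] rep2[of u v] by metis
    qed
    show "d x z \<le> d x y + d y z" if "x \<in> rep ` P" "y \<in> rep ` P" "z \<in> rep ` P" for x y z
      using that rep(1) by (auto simp: d_def intro: triangle)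
    show "0 \<le> d x y" for x y by (simp add: d_def nonneg)
    show "d x y = d y x" for x y using commute[of x y] by (simp add: d_def)
  qed
  moreover have "pseudo_CAT0 (rep ` P) d"
  proof
    fix y z and t :: real assume yz: "y \<in> rep ` P" "z \<in> rep ` P" and t: "0 \<le> t" "t \<le> 1"
    then have yzP: "y \<in> P" "z \<in> P" using sub by auto
    obtain m where m: "m \<in> P" "\<forall>x\<in>P. (\<delta> x m)\<^sup>2 \<le>
        (1 - t) * (\<delta> x y)\<^sup>2 + t * (\<delta> x z)\<^sup>2 - t * (1 - t) * (\<delta> y z)\<^sup>2"
      using comparison[OF yzP t] by blast
    have "d x (rep m) = \<delta> x m" if "x \<in> rep ` P" for x
      using that m(1) rep inv[of m "rep m" x] commute sub by (auto simp: d_def)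
    then have "\<forall>x\<in>rep ` P. (d x (rep m))\<^sup>2 \<le>
        (1 - t) * (d x y)\<^sup>2 + t * (d x z)\<^sup>2 - t * (1 - t) * (d y z)\<^sup>2"
      using m sub yzP by (auto simp: d_def)
    then show "\<exists>m\<in>rep ` P. \<forall>x\<in>rep ` P. (d x m)\<^sup>2 \<le>
        (1 - t) * (d x y)\<^sup>2 + t * (d x z)\<^sup>2 - t * (1 - t) * (d y z)\<^sup>2"
      using m(1) by blast
  next
    show "d x z \<le> d x y + d y z" if "x \<in> rep ` P" "y \<in> rep ` P" "z \<in> rep ` P" for x y z
      using that rep(1) by (auto simp: d_def intro: triangle)
  next
    fix x y assume "x \<in> rep ` P" "y \<in> rep ` P"
    then have xy: "x \<in> P" "y \<in> P" using sub by auto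
    show "d x x = 0" using zero xy by (simp add: d_def)
    show "0 \<le> d x y" using nonneg xy by (simp add: d_def)
    show "d x y = d y x" using commute[OF xy] by (simp add: d_def)
  qed
  ultimately have "CAT0 (rep ` P) d" by (rule pseudo_CAT0_imp_CAT0[rotated])
  moreover have "d (rep x) (rep y) = \<delta> x y" if "x \<in> P" "y \<in> P" for x y
    using that rep rep2 by (auto simp: d_def)
  ultimately show thesis using that[of "rep ` P" d rep] by blast
qed

text \<open>Fibres of \<open>f\<close> acquire diameter 0, which a pseudometric allows, and
  comparison points lift by surjectivity. This rescales \<open>X\<close> and moves it into a type of
  pairs.\<close>

lemma (in pseudo_CAT0) scaled_pullback:
  assumes "f ` Q = P" and "0 \<le> c"
  shows "pseudo_CAT0 Q (\<lambda>x y. c * \<delta> (f x) (f y))"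
proof
  fix y z and t :: real assume yz: "y \<in> Q" "z \<in> Q" and t: "0 \<le> t" "t \<le> 1"
  then have P: "f y \<in> P" "f z \<in> P" using assms by auto
  obtain m where m: "m \<in> P" "\<forall>x\<in>P. (\<delta> x m)\<^sup>2 \<le>
      (1 - t) * (\<delta> x (f y))\<^sup>2 + t * (\<delta> x (f z))\<^sup>2 - t * (1 - t) * (\<delta> (f y) (f z))\<^sup>2"
    using comparison[OF P t] by blast
  obtain n where n: "n \<in> Q" "f n = m" using m(1) assms(1) by auto
  have "(c * \<delta> (f x) (f n))\<^sup>2 \<le>
      (1 - t) * (c * \<delta> (f x) (f y))\<^sup>2 + t * (c * \<delta> (f x) (f z))\<^sup>2
      - t * (1 - t) * (c * \<delta> (f y) (f z))\<^sup>2" if "x \<in> Q" for x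
  proof -
    have "f x \<in> P" using that assms by auto
    then have "c\<^sup>2 * (\<delta> (f x) m)\<^sup>2 \<le> c\<^sup>2 * ((1 - t) * (\<delta> (f x) (f y))\<^sup>2 + t * (\<delta> (f x) (f z))\<^sup>2
        - t * (1 - t) * (\<delta> (f y) (f z))\<^sup>2)"
      using m(2) by (intro mult_left_mono) auto
    then show ?thesis using n by (simp add: power_mult_distrib algebra_simps)
  qed
  then show "\<exists>n\<in>Q. \<forall>x\<in>Q. (c * \<delta> (f x) (f n))\<^sup>2 \<le>
      (1 - t) * (c * \<delta> (f x) (f y))\<^sup>2 + t * (c * \<delta> (f x) (f z))\<^sup>2
      - t * (1 - t) * (c * \<delta> (f y) (f z))\<^sup>2" using n by blast
next
  fix x y z assume "x \<in> Q" "y \<in> Q" "z \<in> Q"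
  then have "c * \<delta> (f x) (f z) \<le> c * (\<delta> (f x) (f y) + \<delta> (f y) (f z))"
    using assms by (intro mult_left_mono triangle) auto
  then show "c * \<delta> (f x) (f z) \<le> c * \<delta> (f x) (f y) + c * \<delta> (f y) (f z)"
    by (simp add: algebra_simps)
next
  fix x y assume "x \<in> Q" "y \<in> Q"
  then have xy: "f x \<in> P" "f y \<in> P" using assms by auto
  show "c * \<delta> (f x) (f x) = 0" using zero xy by simp
  show "0 \<le> c * \<delta> (f x) (f y)" using nonneg xy assms by simp
  show "c * \<delta> (f x) (f y) = c * \<delta> (f y) (f x)" using commute[OF xy] by simp
qed

section \<open>Countable l^2 products of pointed spaces\<close>

lemma minkowski_suminf:
  fixes f g h :: "nat \<Rightarrow> real"
  assumes h: "\<And>n. 0 \<le> h n" "\<And>n. h n \<le> f n + g n"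
    and f: "summable (\<lambda>n. (f n)\<^sup>2)" and g: "summable (\<lambda>n. (g n)\<^sup>2)"
  shows "summable (\<lambda>n. (h n)\<^sup>2)"
    and "sqrt (\<Sum>n. (h n)\<^sup>2) \<le> sqrt (\<Sum>n. (f n)\<^sup>2) + sqrt (\<Sum>n. (g n)\<^sup>2)"
proof -
  have "(h n)\<^sup>2 \<le> 2 * (f n)\<^sup>2 + 2 * (g n)\<^sup>2" for n
  proof -
    have "(h n)\<^sup>2 \<le> (f n + g n)\<^sup>2" using h by (intro power_mono) auto
    also have "\<dots> \<le> 2 * (f n)\<^sup>2 + 2 * (g n)\<^sup>2"
      using sum_squares_ge_zero[of "f n - g n" 0] by (simp add: power2_eq_square algebra_simps)
    finally show ?thesis .
  qed
  moreover have "summable (\<lambda>n. 2 * (f n)\<^sup>2 + 2 * (g n)\<^sup>2)"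
    using f g by (intro summable_add summable_mult)
  ultimately show s: "summable (\<lambda>n. (h n)\<^sup>2)"
    using summable_comparison_test'[of "\<lambda>n. 2 * (f n)\<^sup>2 + 2 * (g n)\<^sup>2" 0 "\<lambda>n. (h n)\<^sup>2"] by simp
  let ?B = "sqrt (\<Sum>n. (f n)\<^sup>2) + sqrt (\<Sum>n. (g n)\<^sup>2)"
  have B0: "0 \<le> ?B" using f g by (intro add_nonneg_nonneg real_sqrt_ge_zero suminf_nonneg) auto
  have "(\<Sum>n<N. (h n)\<^sup>2) \<le> ?B\<^sup>2" for N
  proof -
    have "L2_set h {..<N} \<le> L2_set (\<lambda>n. f n + g n) {..<N}"
      using h by (intro L2_set_mono) auto
    also have "\<dots> \<le> L2_set f {..<N} + L2_set g {..<N}" by (rule L2_set_triangle_ineq)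
    also have "\<dots> \<le> ?B"
      unfolding L2_set_def using f g by (intro add_mono real_sqrt_le_mono sum_le_suminf) auto
    finally have "sqrt (\<Sum>n<N. (h n)\<^sup>2) \<le> ?B" by (simp add: L2_set_def)
    then show ?thesis using B0 by (simp add: real_sqrt_le_iff' sum_nonneg sqrt_le_D)
  qed
  then have "(\<Sum>n. (h n)\<^sup>2) \<le> ?B\<^sup>2" using s by (intro suminf_le_const) auto
  then show "sqrt (\<Sum>n. (h n)\<^sup>2) \<le> ?B" using B0 by (intro real_le_lsqrt)
qed

text \<open>With infinitely many factors the sum of squares may diverge; \<open>b\<close> is a base
  point, and only points at finite distance from it are kept.\<close>

definition l2_carrier :: "(nat \<Rightarrow> 'b set) \<Rightarrow> (nat \<Rightarrow> 'b \<Rightarrow> 'b \<Rightarrow> real) \<Rightarrow> (nat \<Rightarrow> 'b) \<Rightarrow> (nat \<Rightarrow> 'b) set"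
  where "l2_carrier P \<delta> b = {p. (\<forall>n. p n \<in> P n) \<and> summable (\<lambda>n. (\<delta> n (b n) (p n))\<^sup>2)}"

definition l2_dist :: "(nat \<Rightarrow> 'b \<Rightarrow> 'b \<Rightarrow> real) \<Rightarrow> (nat \<Rightarrow> 'b) \<Rightarrow> (nat \<Rightarrow> 'b) \<Rightarrow> real"
  where "l2_dist \<delta> p q = sqrt (\<Sum>n. (\<delta> n (p n) (q n))\<^sup>2)"

lemma pseudo_CAT0_l2_product:
  assumes P: "\<And>n. pseudo_CAT0 (P n) (\<delta> n)" and b: "\<And>n. b n \<in> P n"
  shows "pseudo_CAT0 (l2_carrier P \<delta> b) (l2_dist \<delta>)"
proof -
  let ?Q = "l2_carrier P \<delta> b"
  note facts = pseudo_CAT0.nonneg[OF P] pseudo_CAT0.commute[OF P] pseudo_CAT0.triangle[OF P]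
  have in_P: "p n \<in> P n" if "p \<in> ?Q" for p n using that by (simp add: l2_carrier_def)
  have sm: "summable (\<lambda>n. (\<delta> n (p n) (q n))\<^sup>2)" if "p \<in> ?Q" "q \<in> ?Q" for p q
  proof (rule minkowski_suminf(1))
    show "\<delta> n (p n) (q n) \<le> \<delta> n (b n) (p n) + \<delta> n (b n) (q n)" for n
      using facts(3)[of "p n" n "b n" "q n"] facts(2)[of "p n" n "b n"] in_P that b by auto
    show "0 \<le> \<delta> n (p n) (q n)" for n using facts(1) in_P that by blast
    show "summable (\<lambda>n. (\<delta> n (b n) (p n))\<^sup>2)" "summable (\<lambda>n. (\<delta> n (b n) (q n))\<^sup>2)"
      using that by (simp_all add: l2_carrier_def)
  qed
  have sq: "(l2_dist \<delta> p q)\<^sup>2 = (\<Sum>n. (\<delta> n (p n) (q n))\<^sup>2)" if "p \<in> ?Q" "q \<in> ?Q" for p q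
    using suminf_nonneg[OF sm[OF that]] by (simp add: l2_dist_def)
  show ?thesis
  proof
    fix y z and t :: real assume yz: "y \<in> ?Q" "z \<in> ?Q" and t: "0 \<le> t" "t \<le> 1"
    have "\<forall>n. \<exists>m. m \<in> P n \<and> (\<forall>x\<in>P n. (\<delta> n x m)\<^sup>2 \<le>
        (1 - t) * (\<delta> n x (y n))\<^sup>2 + t * (\<delta> n x (z n))\<^sup>2 - t * (1 - t) * (\<delta> n (y n) (z n))\<^sup>2)"
      using pseudo_CAT0.comparison[OF P in_P[OF yz(1)] in_P[OF yz(2)] t] by blast
    then obtain m where m: "\<And>n. m n \<in> P n" and le: "\<And>n x. x \<in> P n \<Longrightarrow> (\<delta> n x (m n))\<^sup>2 \<le>
        (1 - t) * (\<delta> n x (y n))\<^sup>2 + t * (\<delta> n x (z n))\<^sup>2 - t * (1 - t) * (\<delta> n (y n) (z n))\<^sup>2"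
      by metis
    \<comment> \<open>Tested at the base point, the comparison inequality itself dominates this
      series, so the coordinatewise comparison points form a point of the product.\<close>
    have "summable (\<lambda>n. (\<delta> n (b n) (m n))\<^sup>2)"
    proof (rule summable_comparison_test'[where N = 0])
      show "summable (\<lambda>n. (1 - t) * (\<delta> n (b n) (y n))\<^sup>2 + t * (\<delta> n (b n) (z n))\<^sup>2
          - t * (1 - t) * (\<delta> n (y n) (z n))\<^sup>2)"
        using yz sm[OF yz] by (intro summable_diff summable_add summable_mult) (auto simp: l2_carrier_def)
      show "norm ((\<delta> n (b n) (m n))\<^sup>2) \<le> (1 - t) * (\<delta> n (b n) (y n))\<^sup>2 + t * (\<delta> n (b n) (z n))\<^sup>2
          - t * (1 - t) * (\<delta> n (y n) (z n))\<^sup>2" for n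
        using le[OF b] by simp
    qed
    then have mQ: "m \<in> ?Q" using m by (simp add: l2_carrier_def)
    have "(l2_dist \<delta> x m)\<^sup>2 \<le>
        (1 - t) * (l2_dist \<delta> x y)\<^sup>2 + t * (l2_dist \<delta> x z)\<^sup>2 - t * (1 - t) * (l2_dist \<delta> y z)\<^sup>2"
      if x: "x \<in> ?Q" for x
    proof -
      have "(\<Sum>n. (\<delta> n (x n) (m n))\<^sup>2) \<le> (\<Sum>n. (1 - t) * (\<delta> n (x n) (y n))\<^sup>2 + t * (\<delta> n (x n) (z n))\<^sup>2
          - t * (1 - t) * (\<delta> n (y n) (z n))\<^sup>2)"
        using le in_P x yz mQ by (intro suminf_le summable_diff summable_add summable_mult sm) auto
      also have "\<dots> = (1 - t) * (l2_dist \<delta> x y)\<^sup>2 + t * (l2_dist \<delta> x z)\<^sup>2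
          - t * (1 - t) * (l2_dist \<delta> y z)\<^sup>2"
        using x yz by (simp add: sq sm suminf_diff[symmetric] suminf_add[symmetric]
          suminf_mult summable_diff summable_add summable_mult)
      finally show ?thesis using sq x mQ by simp
    qed
    then show "\<exists>m\<in>?Q. \<forall>x\<in>?Q. (l2_dist \<delta> x m)\<^sup>2 \<le>
        (1 - t) * (l2_dist \<delta> x y)\<^sup>2 + t * (l2_dist \<delta> x z)\<^sup>2 - t * (1 - t) * (l2_dist \<delta> y z)\<^sup>2"
      using mQ by blast
  next
    show "l2_dist \<delta> x z \<le> l2_dist \<delta> x y + l2_dist \<delta> y z" if "x \<in> ?Q" "y \<in> ?Q" "z \<in> ?Q" for x y z
      unfolding l2_dist_def using that
      by (intro minkowski_suminf(2) sm facts(1) facts(3) in_P)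
    show "l2_dist \<delta> x x = 0" if "x \<in> ?Q" for x
      using that in_P pseudo_CAT0.zero[OF P] by (simp add: l2_dist_def)
    show "0 \<le> l2_dist \<delta> x y" if "x \<in> ?Q" "y \<in> ?Q" for x y
      using suminf_nonneg[OF sm[OF that]] by (simp add: l2_dist_def)
    show "l2_dist \<delta> x y = l2_dist \<delta> y x" if "x \<in> ?Q" "y \<in> ?Q" for x y
    proof -
      have "\<delta> n (x n) (y n) = \<delta> n (y n) (x n)" for n using facts(2) in_P that by blast
      then show ?thesis by (simp add: l2_dist_def)
    qed
  qed
qed

section \<open>Comparison of Euclidean and spherical triangles\<close>

text \<open>The difference has derivative \<open>r * sin r\<close>. It supplies the sign of
  \<open>h2 + h\<close>, for \<open>h\<close> the cosine of the distance, in
  \<open>cos_dist_line\<close>.\<close>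

lemma mult_cos_le_sin:
  fixes r :: real assumes "0 \<le> r" "r \<le> pi" shows "r * cos r \<le> sin r"
proof -
  have "(\<lambda>r. sin r - r * cos r) 0 \<le> (\<lambda>r. sin r - r * cos r) r"
  proof (rule DERIV_nonneg_imp_nondecreasing[OF assms(1)])
    fix x assume x: "0 \<le> x" "x \<le> r"
    have "((\<lambda>r. sin r - r * cos r) has_real_derivative x * sin x) (at x)"
      by (auto intro!: derivative_eq_intros)
    moreover have "0 \<le> x * sin x" using x assms by (intro mult_nonneg_nonneg sin_ge_zero) auto
    ultimately show "\<exists>y. ((\<lambda>r. sin r - r * cos r) has_real_derivative y) (at x) \<and> 0 \<le> y" by blast
  qed
  then show ?thesis by simp
qed

text \<open>Sturm comparison: the Wronskian of \<open>k\<close> and \<open>sin\<close> is nonincreasing and starts at 0,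
  so \<open>k / sin\<close> is nonincreasing.\<close>

lemma sturm_nonneg:
  fixes k k1 k2 :: "real \<Rightarrow> real"
  assumes k: "\<And>s. (k has_real_derivative k1 s) (at s)"
    and k1: "\<And>s. (k1 has_real_derivative k2 s) (at s)"
    and le: "\<And>s. 0 \<le> s \<Longrightarrow> s \<le> \<beta> \<Longrightarrow> k2 s + k s \<le> 0"
    and ends: "k 0 = 0" "k \<beta> = 0" and \<beta>: "\<beta> < pi" and s: "0 \<le> s" "s \<le> \<beta>"
  shows "0 \<le> k s"
proof (cases "s = 0")
  case False
  define W where "W s = k1 s * sin s - k s * cos s" for s
  have W: "W x \<le> 0" if "0 \<le> x" "x \<le> \<beta>" for x
  proof -
    have "W x \<le> W 0"
    proof (rule DERIV_nonpos_imp_nonincreasing[OF that(1)])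
      fix y assume y: "0 \<le> y" "y \<le> x"
      have "(W has_real_derivative (k2 y + k y) * sin y) (at y)"
        unfolding W_def by (auto intro!: derivative_eq_intros k k1 simp: algebra_simps)
      moreover have "(k2 y + k y) * sin y \<le> 0"
        using y that \<beta> by (intro mult_nonpos_nonneg le sin_ge_zero) auto
      ultimately show "\<exists>D. (W has_real_derivative D) (at y) \<and> D \<le> 0" by blast
    qed
    then show ?thesis using ends by (simp add: W_def)
  qed
  have pos: "0 < sin x" if "s \<le> x" "x \<le> \<beta>" for x
    using that s False \<beta> by (intro sin_gt_zero) auto
  have "k \<beta> / sin \<beta> \<le> k s / sin s"
  proof (rule DERIV_nonpos_imp_nonincreasing[OF s(2)])
    fix x assume x: "s \<le> x" "x \<le> \<beta>"
    have "((\<lambda>x. k x / sin x) has_real_derivative W x / (sin x * sin x)) (at x)"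
      using pos[OF x] unfolding W_def by (auto intro!: derivative_eq_intros k simp: field_simps)
    moreover have "W x / (sin x * sin x) \<le> 0"
      using W[of x] x s by (intro divide_nonpos_nonneg) auto
    ultimately show "\<exists>D. ((\<lambda>x. k x / sin x) has_real_derivative D) (at x) \<and> D \<le> 0" by blast
  qed
  then show ?thesis using ends pos[of s] s by (simp add: zero_le_divide_iff)
qed (use ends in simp)

text \<open>By convexity the maximum over a segment is attained at an end; hence distances that are
  at most \<open>pi\<close> at both ends stay so along the segment.\<close>

lemma shifted_square_le_max:
  fixes s p \<beta> :: real
  assumes "0 \<le> s" "s \<le> \<beta>"
  shows "(s - p)\<^sup>2 \<le> max (p\<^sup>2) ((\<beta> - p)\<^sup>2)"
proof (cases "s \<le> p")
  case True
  then have "(p - s)\<^sup>2 \<le> p\<^sup>2" using assms by (intro power_mono) auto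
  then show ?thesis by (simp add: power2_commute)
next
  case False
  then have "(s - p)\<^sup>2 \<le> (\<beta> - p)\<^sup>2" using assms by (intro power_mono) auto
  then show ?thesis by simp
qed

text \<open>The function \<open>s \<mapsto> (s - p)\<^sup>2 + Q\<close> is the squared distance in the Euclidean plane from a point
  at distance \<open>sqrt Q\<close> of a line to the points of that line.\<close>

lemma cos_dist_line:
  fixes Q p \<beta> s :: real
  assumes Q: "0 \<le> Q" and \<beta>: "0 \<le> \<beta>" "\<beta> < pi" and s: "0 \<le> s" "s \<le> \<beta>"
    and ends: "p\<^sup>2 + Q \<le> pi\<^sup>2" "(\<beta> - p)\<^sup>2 + Q \<le> pi\<^sup>2"
  shows "sin (\<beta> - s) * cos (sqrt (p\<^sup>2 + Q)) + sin s * cos (sqrt ((\<beta> - p)\<^sup>2 + Q))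
    \<le> sin \<beta> * cos (sqrt ((s - p)\<^sup>2 + Q))"
proof (cases "Q = 0")
  case True
  have "sin (\<beta> - s) * cos p + sin s * cos (\<beta> - p) = sin \<beta> * cos (s - p)"
    unfolding sin_diff cos_diff by algebra
  then show ?thesis using True by simp
next
  case False
  define r where "r s = sqrt ((s - p)\<^sup>2 + Q)" for s
  have r2: "(r s)\<^sup>2 = (s - p)\<^sup>2 + Q" for s using Q by (simp add: r_def)
  have r0: "0 < r s" for s unfolding r_def using Q False
    by (intro real_sqrt_gt_zero add_nonneg_pos) auto
  have dr: "(r has_real_derivative (s - p) / r s) (at s)" for s
  proof -
    have "0 < (s - p)\<^sup>2 + Q" using Q False by (intro add_nonneg_pos) auto
    then show ?thesis unfolding r_def
      by (auto intro!: derivative_eq_intros simp: field_simps)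
  qed
  define h1 where "h1 s = - (s - p) * sin (r s) / r s" for s
  define h2 where "h2 s = - sin (r s) / r s - (s - p)\<^sup>2 * cos (r s) / (r s)\<^sup>2
    + (s - p)\<^sup>2 * sin (r s) / (r s) ^ 3" for s
  define h where "h s = cos (r s)" for s
  have dh: "(h has_real_derivative h1 s) (at s)" for s
    unfolding h_def[abs_def] h1_def using r0[of s] by (auto intro!: derivative_eq_intros dr simp: field_simps)
  have dh1: "(h1 has_real_derivative h2 s) (at s)" for s
  proof -
    have "(h1 has_real_derivative
        ((- 1 * sin (r s) + - (s - p) * (cos (r s) * ((s - p) / r s))) * r s
          - - (s - p) * sin (r s) * ((s - p) / r s)) / (r s * r s)) (at s)"
      unfolding h1_def[abs_def] using r0[of s] by (auto intro!: derivative_eq_intros dr)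
    moreover have "((- 1 * sin (r s) + - (s - p) * (cos (r s) * ((s - p) / r s))) * r s
          - - (s - p) * sin (r s) * ((s - p) / r s)) / (r s * r s) = h2 s"
      unfolding h2_def using r0[of s] by (simp add: divide_simps) algebra
    ultimately show ?thesis by simp
  qed
  \<comment> \<open>Up to the factor \<open>sin \<beta>\<close>, this is \<open>h\<close> minus the
    solution of \<open>y'' + y = 0\<close> with the same values at \<open>0\<close> and
    \<open>\<beta>\<close>. Hence \<open>k'' + k\<close> is
    \<open>sin \<beta> * (h2 + h)\<close>.\<close>
  define k where "k s = sin \<beta> * h s - sin (\<beta> - s) * h 0 - sin s * h \<beta>" for s
  have "0 \<le> k s"
  proof (rule sturm_nonneg[where \<beta> = \<beta> and k = k and s = s
        and ?k1.0 = "\<lambda>s. sin \<beta> * h1 s + cos (\<beta> - s) * h 0 - cos s * h \<beta>"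
        and ?k2.0 = "\<lambda>s. sin \<beta> * h2 s + sin (\<beta> - s) * h 0 + sin s * h \<beta>"])
    show "(k has_real_derivative sin \<beta> * h1 s + cos (\<beta> - s) * h 0 - cos s * h \<beta>) (at s)"
      for s unfolding k_def[abs_def] by (auto intro!: derivative_eq_intros dh)
    show "((\<lambda>s. sin \<beta> * h1 s + cos (\<beta> - s) * h 0 - cos s * h \<beta>) has_real_derivative
        sin \<beta> * h2 s + sin (\<beta> - s) * h 0 + sin s * h \<beta>) (at s)" for s
      by (auto intro!: derivative_eq_intros dh1)
    fix s assume s: "0 \<le> s" "s \<le> \<beta>"
    have "(s - p)\<^sup>2 \<le> max (p\<^sup>2) ((\<beta> - p)\<^sup>2)"
      using s by (rule shifted_square_le_max)
    then have "(r s)\<^sup>2 \<le> pi\<^sup>2" using ends r2 by auto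
    then have rpi: "r s \<le> pi" by (rule power2_le_imp_le) simp
    have "h2 s + h s = Q * (r s * cos (r s) - sin (r s)) / (r s) ^ 3"
    proof -
      have Q': "Q = (r s)\<^sup>2 - (s - p)\<^sup>2" using r2 by simp
      show ?thesis unfolding h2_def h_def Q' using r0[of s] by (simp add: divide_simps) algebra
    qed
    also have "\<dots> \<le> 0" using mult_cos_le_sin[of "r s"] rpi r0[of s] Q
      by (intro divide_nonpos_nonneg mult_nonneg_nonpos) auto
    finally have "sin \<beta> * (h2 s + h s) \<le> 0"
      using \<beta> by (intro mult_nonneg_nonpos sin_ge_zero) auto
    then show "sin \<beta> * h2 s + sin (\<beta> - s) * h 0 + sin s * h \<beta> + k s \<le> 0"
      by (simp add: k_def algebra_simps)
  next
    show "k 0 = 0" "k \<beta> = 0" by (simp_all add: k_def)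
    show "\<beta> < pi" "0 \<le> s" "s \<le> \<beta>" by fact+
  qed
  then show ?thesis by (simp add: k_def h_def r_def)
qed

lemma sin_add_le:
  fixes x y :: real
  assumes "0 \<le> x" "0 \<le> y" "x + y \<le> pi" shows "sin (x + y) \<le> sin x + sin y"
proof -
  have "sin x * cos y \<le> sin x * 1" "cos x * sin y \<le> 1 * sin y"
    using assms by (intro mult_left_mono mult_right_mono sin_ge_zero; auto)+
  then show ?thesis by (simp add: sin_add)
qed

text \<open>The point at parameter \<open>s\<close> lies outside the disc of radius \<open>pi\<close>, hence \<open>b\<close> is at least
  \<open>pi - (\<beta> - s)\<close>.\<close>

lemma cos_dist_outside:
  fixes b \<beta> s :: real
  assumes "\<beta> < pi" "0 \<le> s" "s \<le> \<beta>" "pi - (\<beta> - s) \<le> b" "b \<le> pi"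
  shows "- sin (\<beta> - s) + sin s * cos b \<le> - sin \<beta>"
proof -
  have "cos b \<le> cos (pi - (\<beta> - s))" using assms by (subst cos_mono_le_eq) auto
  then have b: "cos b \<le> - cos (\<beta> - s)" by simp
  \<comment> \<open>Once \<open>2 * sin (s/2)\<close> is factored out, the claim reads
    \<open>cos (s/2) * cos b \<le> - cos (\<beta> - s/2)\<close>. By \<open>b\<close> it suffices
    that \<open>cos (s/2) * cos (\<beta> - s)\<close>, the average of the two cosines compared here,
    is at least the smaller one.\<close>
  have "cos (\<beta> - s/2) \<le> cos \<bar>\<beta> - 3 * s/2\<bar>" using assms by (subst cos_mono_le_eq) auto
  then have c: "cos (\<beta> - s/2) \<le> cos (\<beta> - 3 * s/2)" by simp
  have e: "2 * (cos (s/2) * cos (\<beta> - s)) = cos (\<beta> - s/2) + cos (\<beta> - 3 * s/2)"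
  proof -
    have "\<beta> - s - s/2 = \<beta> - 3 * s/2" "\<beta> - s + s/2 = \<beta> - s/2" by simp_all
    then have "cos (\<beta> - s) * cos (s/2) = (cos (\<beta> - 3 * s/2) + cos (\<beta> - s/2)) / 2"
      using cos_times_cos[of "\<beta> - s" "s/2"] by simp
    then show ?thesis by (simp add: mult.commute)
  qed
  have "cos (s/2) * cos b \<le> cos (s/2) * - cos (\<beta> - s)"
    using assms by (intro mult_left_mono b cos_ge_zero) auto
  also have "\<dots> \<le> - cos (\<beta> - s/2)" using c e by simp
  finally have "2 * sin (s/2) * (cos (s/2) * cos b + cos (\<beta> - s/2)) \<le> 0"
    using assms by (intro mult_nonneg_nonpos mult_nonneg_nonneg sin_ge_zero) auto
  moreover have "sin s = 2 * sin (s/2) * cos (s/2)" using sin_double[of "s/2"] by simp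
  moreover have "sin \<beta> - sin (\<beta> - s) = 2 * sin (s/2) * cos (\<beta> - s/2)"
    using sin_diff_sin[of \<beta> "\<beta> - s"] by (simp add: field_simps)
  ultimately show ?thesis by (simp add: algebra_simps)
qed

text \<open>The end at parameter 0 is not inside the disc of radius \<open>pi\<close>, so its
  truncated distance has cosine \<open>-1\<close>. For a point inside the disc, the segment is cut
  at the parameter \<open>s'\<close> where it meets the circle: \<open>cos_dist_line\<close> handles
  the piece from \<open>s'\<close> on, and \<open>cos_dist_outside\<close> the point
  \<open>s'\<close> itself.\<close>

lemma cos_dist_line_mixed:
  fixes Q p \<beta> s :: real
  assumes Q: "0 \<le> Q" and \<beta>: "\<beta> < pi" and s: "0 \<le> s" "s \<le> \<beta>"
    and ends: "pi\<^sup>2 \<le> p\<^sup>2 + Q" "(\<beta> - p)\<^sup>2 + Q \<le> pi\<^sup>2"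
  shows "- sin (\<beta> - s) + sin s * cos (sqrt ((\<beta> - p)\<^sup>2 + Q))
    \<le> sin \<beta> * cos (min (sqrt ((s - p)\<^sup>2 + Q)) pi)"
proof -
  define b where "b = sqrt ((\<beta> - p)\<^sup>2 + Q)"
  have b: "b \<le> pi" unfolding b_def using ends by (intro real_le_lsqrt) auto
  have outside: "- sin (\<beta> - s) + sin s * cos b \<le> - sin \<beta>"
    if "0 \<le> s" "s \<le> \<beta>" "pi\<^sup>2 \<le> (s - p)\<^sup>2 + Q" for s
  proof -
    have "pi \<le> sqrt ((s - p)\<^sup>2 + Q)" using that by (intro real_le_rsqrt)
    also have "\<dots> = sqrt (((\<beta> - p) - (\<beta> - s))\<^sup>2 + (sqrt Q - 0)\<^sup>2)" using Q by (simp add: power2_commute)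
    also have "\<dots> \<le> b + (\<beta> - s)"
      using real_sqrt_sum_squares_triangle_ineq[of "\<beta> - p" "- (\<beta> - s)" "sqrt Q" 0] Q that
      by (simp add: b_def)
    finally show ?thesis using that b \<beta> by (intro cos_dist_outside) auto
  qed
  show ?thesis
  proof (cases "pi\<^sup>2 \<le> (s - p)\<^sup>2 + Q")
    case True
    then have "pi \<le> sqrt ((s - p)\<^sup>2 + Q)" by (intro real_le_rsqrt)
    then show ?thesis using outside[OF s True] by (simp add: b_def min_def)
  next
    case False
    have "\<exists>x\<ge>0. x \<le> s \<and> (x - p)\<^sup>2 + Q = pi\<^sup>2"
      using False s ends by (intro IVT2') (auto intro!: continuous_intros)
    then obtain s' where s': "0 \<le> s'" "s' \<le> s" "(s' - p)\<^sup>2 + Q = pi\<^sup>2" by blast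
    have ne: "s' < s" using s' False by (cases "s' = s") auto
    define h where "h = cos (sqrt ((s - p)\<^sup>2 + Q))"
    have pos: "0 < sin (\<beta> - s')" using ne s s' \<beta> by (intro sin_gt_zero) auto
    have sq: "sqrt ((s' - p)\<^sup>2 + Q) = pi" "(p - s')\<^sup>2 + Q = pi\<^sup>2"
      using s'(3) by (auto simp: power2_commute)
    have "sin ((\<beta> - s') - (s - s')) * cos (sqrt ((p - s')\<^sup>2 + Q))
        + sin (s - s') * cos (sqrt (((\<beta> - s') - (p - s'))\<^sup>2 + Q))
        \<le> sin (\<beta> - s') * cos (sqrt (((s - s') - (p - s'))\<^sup>2 + Q))"
      using Q \<beta> s s' ends sq by (intro cos_dist_line) auto
    then have "- sin (\<beta> - s) + sin (s - s') * cos b \<le> sin (\<beta> - s') * h"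
      using sq by (simp add: b_def h_def)
    then have 1: "sin \<beta> * (- sin (\<beta> - s) + sin (s - s') * cos b) \<le> sin \<beta> * (sin (\<beta> - s') * h)"
      using s \<beta> by (intro mult_left_mono sin_ge_zero) auto
    have 2: "sin (\<beta> - s) * (- sin (\<beta> - s') + sin s' * cos b) \<le> sin (\<beta> - s) * (- sin \<beta>)"
      using s s' \<beta> by (intro mult_left_mono sin_ge_zero outside) auto
    \<comment> \<open>This merges the \<open>cos b\<close> terms of 1 and 2 into
      \<open>sin s * cos b\<close> times \<open>sin (\<beta> - s')\<close>; that positive factor is
      cancelled at the end.\<close>
    have 3: "sin (\<beta> - s) * sin s' + sin \<beta> * sin (s - s') = sin (\<beta> - s') * sin s"
      unfolding sin_diff by algebra
    have "sin (\<beta> - s') * (- sin (\<beta> - s) + sin s * cos b) =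
        sin (\<beta> - s) * (- sin (\<beta> - s') + sin s' * cos b) + sin \<beta> * (sin (s - s') * cos b)"
      using arg_cong[OF 3, of "\<lambda>x. x * cos b"] by (simp add: algebra_simps)
    also have "\<dots> \<le> sin (\<beta> - s') * (sin \<beta> * h)"
      using 1 2 by (simp add: algebra_simps)
    finally have "- sin (\<beta> - s) + sin s * cos b \<le> sin \<beta> * h"
      using pos by (simp add: mult_le_cancel_left_pos)
    moreover have "sqrt ((s - p)\<^sup>2 + Q) \<le> pi" using False by (intro real_le_lsqrt) auto
    ultimately show ?thesis by (simp add: b_def h_def min_def)
  qed
qed

text \<open>A triangle with sides \<open>a\<close>, \<open>b\<close>, \<open>\<beta>\<close> is
  drawn in the Euclidean plane with side \<open>\<beta>\<close> on a line. By Stewart's theorem the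
  bound on \<open>c\<^sup>2\<close> is the squared distance from the opposite vertex to the point
  dividing that side at \<open>l\<close>, so only this planar configuration matters. The cases
  record which of \<open>a\<close> and \<open>b\<close> are truncated.\<close>

lemma spherical_comparison:
  fixes a b c \<beta> l :: real
  assumes nn: "0 \<le> a" "0 \<le> b" "0 \<le> c" and tri: "a \<le> b + \<beta>" "b \<le> a + \<beta>" "\<beta> \<le> a + b"
    and \<beta>: "0 < \<beta>" "\<beta> < pi" and l: "0 \<le> l" "l \<le> 1"
    and c: "c\<^sup>2 \<le> (1 - l) * a\<^sup>2 + l * b\<^sup>2 - l * (1 - l) * \<beta>\<^sup>2"
  shows "sin ((1 - l) * \<beta>) * cos (min a pi) + sin (l * \<beta>) * cos (min b pi)
    \<le> sin \<beta> * cos (min c pi)"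
proof -
  define s where "s = l * \<beta>"
  have s: "0 \<le> s" "s \<le> \<beta>" using l \<beta> by (auto simp: s_def mult_le_cancel_right1 mult_left_le_one_le)
  have ms: "(1 - l) * \<beta> = \<beta> - s" by (simp add: s_def algebra_simps)
  \<comment> \<open>Law of cosines: \<open>p\<close> is the foot of the perpendicular from the
    vertex, measured along the line from the end at distance \<open>a\<close>; \<open>Q\<close>
    below is the squared height.\<close>
  define p where "p = (a\<^sup>2 + \<beta>\<^sup>2 - b\<^sup>2) / (2 * \<beta>)"
  have p: "2 * p * \<beta> = a\<^sup>2 + \<beta>\<^sup>2 - b\<^sup>2" using \<beta> by (simp add: p_def)
  define Q where "Q = a\<^sup>2 - p\<^sup>2"
  have "\<bar>p\<bar> \<le> a"
  proof -
    have "b\<^sup>2 \<le> (a + \<beta>)\<^sup>2" using tri nn by (intro power_mono) auto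
    moreover have "(a - \<beta>)\<^sup>2 \<le> b\<^sup>2" using tri by (intro abs_le_square_iff[THEN iffD1]) auto
    ultimately have "\<bar>p * \<beta>\<bar> \<le> a * \<beta>" using p by (auto simp: power2_eq_square algebra_simps abs_le_iff)
    then show ?thesis using \<beta> by (simp add: abs_mult)
  qed
  then have Q: "0 \<le> Q" using nn by (simp add: Q_def abs_le_square_iff[symmetric])
  have a: "p\<^sup>2 + Q = a\<^sup>2" and b: "(\<beta> - p)\<^sup>2 + Q = b\<^sup>2"
    using p by (auto simp: Q_def power2_eq_square algebra_simps)
  have "(1 - l) * a\<^sup>2 + l * b\<^sup>2 - l * (1 - l) * \<beta>\<^sup>2 = (s - p)\<^sup>2 + Q"
    unfolding a[symmetric] b[symmetric] s_def by (simp add: power2_eq_square algebra_simps)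
  then have c': "c \<le> sqrt ((s - p)\<^sup>2 + Q)" using c by (intro real_le_rsqrt) simp
  have s\<beta>: "0 \<le> sin \<beta>" using \<beta> by (intro sin_ge_zero) auto
  have "cos (min (sqrt ((s - p)\<^sup>2 + Q)) pi) \<le> cos (min c pi)"
    using c' nn Q by (subst cos_mono_le_eq) auto
  then have mono: "sin \<beta> * cos (min (sqrt ((s - p)\<^sup>2 + Q)) pi) \<le> sin \<beta> * cos (min c pi)"
    using s\<beta> by (rule mult_left_mono)
  have sa: "sqrt (p\<^sup>2 + Q) = a" "sqrt ((\<beta> - p)\<^sup>2 + Q) = b" using a b nn by auto
  have le_pi: "x\<^sup>2 \<le> pi\<^sup>2" if "0 \<le> x" "x \<le> pi" for x
    using that by (intro power_mono) auto
  have ge_pi: "pi\<^sup>2 \<le> x\<^sup>2" if "pi \<le> x" for x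
    using that by (intro power_mono) auto
  consider "a \<le> pi" "b \<le> pi" | "pi \<le> a" "b \<le> pi" | "a \<le> pi" "pi \<le> b" | "pi \<le> a" "pi \<le> b"
    by linarith
  then have "sin (\<beta> - s) * cos (min a pi) + sin s * cos (min b pi) \<le> sin \<beta> * cos (min c pi)"
  proof cases
    case 1
    have "max (p\<^sup>2) ((\<beta> - p)\<^sup>2) + Q \<le> pi\<^sup>2" using 1 le_pi[of a] le_pi[of b] nn a b by linarith
    have "(s - p)\<^sup>2 \<le> max (p\<^sup>2) ((\<beta> - p)\<^sup>2)"
      using s by (rule shifted_square_le_max)
    then have "(s - p)\<^sup>2 + Q \<le> pi\<^sup>2" using \<open>max (p\<^sup>2) ((\<beta> - p)\<^sup>2) + Q \<le> pi\<^sup>2\<close> by linarith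
    then have "sqrt ((s - p)\<^sup>2 + Q) \<le> pi" by (intro real_le_lsqrt) auto
    moreover have "sin (\<beta> - s) * cos a + sin s * cos b \<le> sin \<beta> * cos (sqrt ((s - p)\<^sup>2 + Q))"
      using cos_dist_line[OF Q _ \<beta>(2) s, of p] \<beta>(1) 1 le_pi nn
      unfolding a b sa by auto
    ultimately show ?thesis using mono 1 by (simp add: min_def)
  next
    case 2
    have "- sin (\<beta> - s) + sin s * cos b \<le> sin \<beta> * cos (min (sqrt ((s - p)\<^sup>2 + Q)) pi)"
      using cos_dist_line_mixed[OF Q \<beta>(2) s, of p] 2 le_pi ge_pi nn
      unfolding a b sa by auto
    then show ?thesis using mono 2 by (simp add: min_def split: if_splits)
  next
    case 3
    \<comment> \<open>The segment is traversed backwards, replacing \<open>s\<close> and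
      \<open>p\<close> by \<open>\<beta> - s\<close> and \<open>\<beta> - p\<close>, so that the
      truncated end comes first.\<close>
    have "- sin (\<beta> - (\<beta> - s)) + sin (\<beta> - s) * cos (sqrt ((\<beta> - (\<beta> - p))\<^sup>2 + Q))
        \<le> sin \<beta> * cos (min (sqrt (((\<beta> - s) - (\<beta> - p))\<^sup>2 + Q)) pi)"
      using 3 le_pi[of a] ge_pi[of b] nn a b s Q \<beta> by (intro cos_dist_line_mixed) simp_all
    then have "sin (\<beta> - s) * cos a - sin s \<le> sin \<beta> * cos (min (sqrt ((s - p)\<^sup>2 + Q)) pi)"
      using sa by (simp add: power2_commute[of p s])
    then show ?thesis using mono 3 by (simp add: min_def split: if_splits)
  next
    case 4
    have "sin \<beta> \<le> sin (\<beta> - s) + sin s" using sin_add_le[of "\<beta> - s" s] s \<beta> by simp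
    moreover have "sin \<beta> * (-1) \<le> sin \<beta> * cos (min c pi)" using s\<beta> by (intro mult_left_mono) auto
    ultimately show ?thesis using 4 by (simp add: min_def split: if_splits)
  qed
  then show ?thesis unfolding ms s_def[symmetric] .
qed

section \<open>Euclidean cones\<close>

text \<open>A pair is a direction and a radius, and the formula is the law of cosines. The apex is
  represented by every pair of radius 0.\<close>

definition cone_dist :: "('a \<Rightarrow> 'a \<Rightarrow> real) \<Rightarrow> 'a \<times> real \<Rightarrow> 'a \<times> real \<Rightarrow> real" where
  "cone_dist \<theta> p q =
    sqrt ((snd p)\<^sup>2 + (snd q)\<^sup>2 - 2 * snd p * snd q * cos (\<theta> (fst p) (fst q)))"

lemma law_of_cosines_nonneg: "0 \<le> (r::real)\<^sup>2 + s\<^sup>2 - 2 * r * s * cos a"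
proof -
  have "r\<^sup>2 + s\<^sup>2 - 2 * r * s * cos a = (r * cos a - s)\<^sup>2 + (r * sin a)\<^sup>2"
    using sin_cos_squared_add[of a] by algebra
  then show ?thesis by simp
qed

lemma cone_dist_square:
  "(cone_dist \<theta> (x, r) (y, s))\<^sup>2 = r\<^sup>2 + s\<^sup>2 - 2 * r * s * cos (\<theta> x y)"
  using law_of_cosines_nonneg[of r s "\<theta> x y"] by (simp add: cone_dist_def)

text \<open>This is the triangle inequality in the plane for vectors of lengths \<open>r\<close>,
  \<open>s\<close>, \<open>t\<close> at angles \<open>a\<close>, \<open>0\<close>,
  \<open>- b\<close>; the first components are measured along the middle vector.\<close>

lemma law_of_cosines_triangle:
  fixes r s t a b :: real
  shows "sqrt (r\<^sup>2 + t\<^sup>2 - 2 * r * t * cos (a + b)) \<le>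
    sqrt (r\<^sup>2 + s\<^sup>2 - 2 * r * s * cos a) + sqrt (s\<^sup>2 + t\<^sup>2 - 2 * s * t * cos b)"
proof -
  have "(r * cos a - s + (s - t * cos b))\<^sup>2 + (r * sin a + t * sin b)\<^sup>2 =
      r\<^sup>2 + t\<^sup>2 - 2 * r * t * cos (a + b)"
    using sin_cos_squared_add[of a] sin_cos_squared_add[of b] unfolding cos_add by algebra
  moreover have "(r * cos a - s)\<^sup>2 + (r * sin a)\<^sup>2 = r\<^sup>2 + s\<^sup>2 - 2 * r * s * cos a"
    using sin_cos_squared_add[of a] by algebra
  moreover have "(s - t * cos b)\<^sup>2 + (t * sin b)\<^sup>2 = s\<^sup>2 + t\<^sup>2 - 2 * s * t * cos b"
    using sin_cos_squared_add[of b] by algebra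
  ultimately show ?thesis
    using real_sqrt_sum_squares_triangle_ineq[of "r * cos a - s" "s - t * cos b" "r * sin a" "t * sin b"]
    by simp
qed

lemma law_of_cosines_mono:
  fixes r s a b :: real
  assumes "0 \<le> r" "0 \<le> s" "0 \<le> a" "a \<le> b" "b \<le> pi"
  shows "sqrt (r\<^sup>2 + s\<^sup>2 - 2 * r * s * cos a) \<le> sqrt (r\<^sup>2 + s\<^sup>2 - 2 * r * s * cos b)"
proof -
  have "2 * r * s * cos b \<le> 2 * r * s * cos a"
    using assms by (intro mult_left_mono) (auto simp: cos_mono_le_eq)
  then show ?thesis by simp
qed

text \<open>The last assumption is the comparison inequality of a CAT(1) space, for sides shorter than
  \<open>pi\<close>; the angles \<open>\<theta>\<close> are already truncated at \<open>pi\<close>.\<close>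

locale angular_metric =
  fixes X :: "'a set" and \<theta> :: "'a \<Rightarrow> 'a \<Rightarrow> real"
  assumes zero: "x \<in> X \<Longrightarrow> \<theta> x x = 0"
    and nonneg: "x \<in> X \<Longrightarrow> y \<in> X \<Longrightarrow> 0 \<le> \<theta> x y"
    and le_pi: "x \<in> X \<Longrightarrow> y \<in> X \<Longrightarrow> \<theta> x y \<le> pi"
    and commute: "x \<in> X \<Longrightarrow> y \<in> X \<Longrightarrow> \<theta> x y = \<theta> y x"
    and triangle: "x \<in> X \<Longrightarrow> y \<in> X \<Longrightarrow> z \<in> X \<Longrightarrow> \<theta> x z \<le> \<theta> x y + \<theta> y z"
    and comparison: "y \<in> X \<Longrightarrow> z \<in> X \<Longrightarrow> 0 < \<theta> y z \<Longrightarrow> \<theta> y z < pi \<Longrightarrow> 0 \<le> l \<Longrightarrow> l \<le> 1 \<Longrightarrow>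
      \<exists>m\<in>X. \<forall>x\<in>X. sin ((1 - l) * \<theta> y z) * cos (\<theta> x y) + sin (l * \<theta> y z) * cos (\<theta> x z)
        \<le> sin (\<theta> y z) * cos (\<theta> x m)"
begin

text \<open>The vectors of lengths \<open>A\<close> and \<open>B\<close> enclosing the angle \<open>\<theta> y z\<close> have a sum of length \<open>\<rho>\<close>,
  whose direction divides that angle in the ratio in which \<open>m\<close> divides the geodesic from \<open>y\<close>
  to \<open>z\<close>; if \<open>\<theta> y z = pi\<close>, the sum points in the direction of the longer vector.\<close>

lemma vector_sum:
  assumes yz: "y \<in> X" "z \<in> X" and AB: "0 \<le> A" "0 \<le> B"
  obtains m \<rho> where "m \<in> X" "0 \<le> \<rho>" "\<rho>\<^sup>2 = A\<^sup>2 + B\<^sup>2 + 2 * A * B * cos (\<theta> y z)"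
    "\<And>x. x \<in> X \<Longrightarrow> A * cos (\<theta> x y) + B * cos (\<theta> x z) \<le> \<rho> * cos (\<theta> x m)"
proof -
  consider "\<theta> y z = 0" | "0 < \<theta> y z" "\<theta> y z < pi" | "\<theta> y z = pi"
    using nonneg le_pi yz by fastforce
  then show thesis
  proof cases
    case 1
    have "\<theta> x z = \<theta> x y" if "x \<in> X" for x
      using triangle[OF that yz] triangle[OF that yz(2,1)] commute[OF yz] 1 by simp
    then have "A * cos (\<theta> x y) + B * cos (\<theta> x z) \<le> (A + B) * cos (\<theta> x y)" if "x \<in> X" for x
      using that by (simp add: algebra_simps)
    then show thesis using that[of y "A + B"] yz AB 1 by (simp add: power2_eq_square algebra_simps)
  next
    case 2
    define \<beta> where "\<beta> = \<theta> y z"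
    have s\<beta>: "0 < sin \<beta>" using 2 by (simp add: \<beta>_def sin_gt_zero)
    \<comment> \<open>\<open>\<alpha>\<close> is the angle between the first vector and the sum: the
      components perpendicular to the sum cancel, and those along it add up to
      \<open>\<rho>\<close>.\<close>
    have "\<exists>\<alpha>\<ge>0. \<alpha> \<le> \<beta> \<and> A * sin \<alpha> - B * sin (\<beta> - \<alpha>) = 0"
      using AB s\<beta> 2 by (intro IVT') (auto intro!: continuous_intros simp: \<beta>_def)
    then obtain \<alpha> where \<alpha>: "0 \<le> \<alpha>" "\<alpha> \<le> \<beta>" "A * sin \<alpha> = B * sin (\<beta> - \<alpha>)" by auto
    define \<rho> where "\<rho> = A * cos \<alpha> + B * cos (\<beta> - \<alpha>)"
    have sum: "sin \<beta> = sin \<alpha> * cos (\<beta> - \<alpha>) + cos \<alpha> * sin (\<beta> - \<alpha>)"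
      "cos \<beta> = cos \<alpha> * cos (\<beta> - \<alpha>) - sin \<alpha> * sin (\<beta> - \<alpha>)"
      using sin_add[of \<alpha> "\<beta> - \<alpha>"] cos_add[of \<alpha> "\<beta> - \<alpha>"] by simp_all
    have B: "\<rho> * sin \<alpha> = B * sin \<beta>" and A: "\<rho> * sin (\<beta> - \<alpha>) = A * sin \<beta>"
      unfolding \<rho>_def sum using \<alpha>(3) by algebra+
    have \<rho>2: "\<rho>\<^sup>2 = A\<^sup>2 + B\<^sup>2 + 2 * A * B * cos \<beta>"
      unfolding \<rho>_def sum using \<alpha>(3) sin_cos_squared_add[of \<alpha>] sin_cos_squared_add[of "\<beta> - \<alpha>"]
      by algebra
    have "0 \<le> \<rho>"
    proof (rule ccontr)
      assume "\<not> 0 \<le> \<rho>"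
      moreover have "0 \<le> sin \<alpha>" "0 \<le> sin (\<beta> - \<alpha>)"
        using \<alpha> 2 by (auto intro!: sin_ge_zero simp: \<beta>_def)
      moreover have "0 \<le> \<rho> * sin \<alpha>" "0 \<le> \<rho> * sin (\<beta> - \<alpha>)" using A B AB s\<beta> by simp_all
      ultimately have "sin \<alpha> = 0" "sin (\<beta> - \<alpha>) = 0"
        by (auto simp: zero_le_mult_iff)
      then show False using sum s\<beta> by simp
    qed
    define l where "l = \<alpha> / \<beta>"
    have l: "0 \<le> l" "l \<le> 1" "(1 - l) * \<beta> = \<beta> - \<alpha>" "l * \<beta> = \<alpha>"
      using \<alpha> 2 by (auto simp: l_def \<beta>_def field_simps)
    obtain m where m: "m \<in> X" "\<And>x. x \<in> X \<Longrightarrow>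
        sin (\<beta> - \<alpha>) * cos (\<theta> x y) + sin \<alpha> * cos (\<theta> x z) \<le> sin \<beta> * cos (\<theta> x m)"
      using comparison[OF yz 2 l(1,2)] l(3,4) unfolding \<beta>_def[symmetric] by auto
    have "A * cos (\<theta> x y) + B * cos (\<theta> x z) \<le> \<rho> * cos (\<theta> x m)" if "x \<in> X" for x
    proof -
      have "sin \<beta> * (A * cos (\<theta> x y) + B * cos (\<theta> x z)) =
          \<rho> * (sin (\<beta> - \<alpha>) * cos (\<theta> x y) + sin \<alpha> * cos (\<theta> x z))"
        using A B by algebra
      also have "\<dots> \<le> \<rho> * (sin \<beta> * cos (\<theta> x m))"
        using m(2)[OF that] \<open>0 \<le> \<rho>\<close> by (rule mult_left_mono)
      finally have "sin \<beta> * (A * cos (\<theta> x y) + B * cos (\<theta> x z)) \<le> sin \<beta> * (\<rho> * cos (\<theta> x m))"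
        by (simp add: algebra_simps)
      then show ?thesis using s\<beta> by simp
    qed
    then show thesis using that[of m \<rho>] m(1) \<open>0 \<le> \<rho>\<close> \<rho>2 by (simp add: \<beta>_def)
  next
    case 3
    have opp: "cos (\<theta> x y) + cos (\<theta> x z) \<le> 0" if x: "x \<in> X" for x
    proof -
      have "pi - \<theta> x y \<le> \<theta> x z"
        using triangle[OF yz(1) x yz(2)] commute[OF yz(1) x] 3 by simp
      then have "cos (\<theta> x z) \<le> cos (pi - \<theta> x y)"
        using nonneg le_pi x yz by (subst cos_mono_le_eq) auto
      then show ?thesis by simp
    qed
    show thesis
    proof (cases "B \<le> A")
      case True
      have "A * cos (\<theta> x y) + B * cos (\<theta> x z) \<le> (A - B) * cos (\<theta> x y)" if "x \<in> X" for x
        using mult_nonneg_nonpos[OF AB(2) opp[OF that]] by (simp add: algebra_simps)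
      then show thesis
        using that[of y "A - B"] yz 3 True by (simp add: power2_eq_square algebra_simps)
    next
      case False
      have "A * cos (\<theta> x y) + B * cos (\<theta> x z) \<le> (B - A) * cos (\<theta> x z)" if "x \<in> X" for x
        using mult_nonneg_nonpos[OF AB(1) opp[OF that]] by (simp add: algebra_simps)
      then show thesis
        using that[of z "B - A"] yz 3 False by (simp add: power2_eq_square algebra_simps)
    qed
  qed
qed

theorem pseudo_CAT0_cone: "pseudo_CAT0 (X \<times> {0..}) (cone_dist \<theta>)"
proof
  fix p q assume "p \<in> X \<times> {0::real..}" "q \<in> X \<times> {0::real..}"
  then obtain x r y s where p: "p = (x, r)" "x \<in> X" "0 \<le> r" and q: "q = (y, s)" "y \<in> X" "0 \<le> s"
    by auto
  show "cone_dist \<theta> p p = 0" using zero[OF p(2)] p(1)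
    by (simp add: cone_dist_def power2_eq_square)
  show "0 \<le> cone_dist \<theta> p q" using law_of_cosines_nonneg by (simp add: cone_dist_def)
  show "cone_dist \<theta> p q = cone_dist \<theta> q p"
    using commute[OF p(2) q(2)] p q by (simp add: cone_dist_def algebra_simps)
  fix w assume "w \<in> X \<times> {0::real..}"
  then obtain z t where w: "w = (z, t)" "z \<in> X" "0 \<le> t" by auto
  \<comment> \<open>Cosine is monotone only up to \<open>pi\<close>, so the second angle is shrunk
    until both together are at most \<open>pi\<close>; \<open>\<theta> x z\<close> still does not
    exceed their sum.\<close>
  define b where "b = min (\<theta> y z) (pi - \<theta> x y)"
  have b: "0 \<le> b" "b \<le> \<theta> y z" "\<theta> y z \<le> pi" "\<theta> x z \<le> \<theta> x y + b" "\<theta> x y + b \<le> pi"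
    using nonneg le_pi triangle p q w by (auto simp: b_def min_def)
  have "cone_dist \<theta> p w \<le> sqrt (r\<^sup>2 + t\<^sup>2 - 2 * r * t * cos (\<theta> x y + b))"
    using law_of_cosines_mono[of r t "\<theta> x z" "\<theta> x y + b"] nonneg[OF p(2) w(2)] p w b
    by (simp add: cone_dist_def)
  also have "\<dots> \<le> cone_dist \<theta> p q + sqrt (s\<^sup>2 + t\<^sup>2 - 2 * s * t * cos b)"
    using law_of_cosines_triangle[of r t "\<theta> x y" b s] p q by (simp add: cone_dist_def)
  also have "sqrt (s\<^sup>2 + t\<^sup>2 - 2 * s * t * cos b) \<le> cone_dist \<theta> q w"
    using law_of_cosines_mono[of s t b "\<theta> y z"] q w b by (simp add: cone_dist_def)
  finally show "cone_dist \<theta> p w \<le> cone_dist \<theta> p q + cone_dist \<theta> q w" by simp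
next
  fix q w and t :: real assume "q \<in> X \<times> {0::real..}" "w \<in> X \<times> {0::real..}" and t: "0 \<le> t" "t \<le> 1"
  then obtain y s z u where q: "q = (y, s)" "y \<in> X" "0 \<le> s" and w: "w = (z, u)" "z \<in> X" "0 \<le> u"
    by auto
  \<comment> \<open>The comparison point plays the role of the vector
    \<open>(1 - t) * q + t * w\<close>. In a Euclidean space the comparison inequality would be an
    equality; here only the inner products with \<open>p\<close> produce an inequality.\<close>
  obtain m \<rho> where m: "m \<in> X" "0 \<le> \<rho>"
      "\<rho>\<^sup>2 = ((1 - t) * s)\<^sup>2 + (t * u)\<^sup>2 + 2 * ((1 - t) * s) * (t * u) * cos (\<theta> y z)"
    and le: "\<And>x. x \<in> X \<Longrightarrow>
      ((1 - t) * s) * cos (\<theta> x y) + (t * u) * cos (\<theta> x z) \<le> \<rho> * cos (\<theta> x m)"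
    using vector_sum[OF q(2) w(2), of "(1 - t) * s" "t * u"] t q w by auto
  have "(cone_dist \<theta> p (m, \<rho>))\<^sup>2 \<le> (1 - t) * (cone_dist \<theta> p q)\<^sup>2 + t * (cone_dist \<theta> p w)\<^sup>2
      - t * (1 - t) * (cone_dist \<theta> q w)\<^sup>2" if pX: "p \<in> X \<times> {0..}" for p
  proof -
    obtain x r where p: "p = (x, r)" "x \<in> X" "0 \<le> r" using pX by auto
    have "2 * r * (((1 - t) * s) * cos (\<theta> x y) + (t * u) * cos (\<theta> x z))
        \<le> 2 * r * (\<rho> * cos (\<theta> x m))"
      using le[OF p(2)] p(3) by (intro mult_left_mono) auto
    then have "(cone_dist \<theta> p (m, \<rho>))\<^sup>2 \<le> r\<^sup>2 + \<rho>\<^sup>2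
        - 2 * r * (((1 - t) * s) * cos (\<theta> x y) + (t * u) * cos (\<theta> x z))"
      unfolding p cone_dist_square by (simp add: algebra_simps)
    also have "\<dots> = (1 - t) * (cone_dist \<theta> p q)\<^sup>2 + t * (cone_dist \<theta> p w)\<^sup>2
      - t * (1 - t) * (cone_dist \<theta> q w)\<^sup>2"
      unfolding p q w cone_dist_square m(3) by algebra
    finally show ?thesis .
  qed
  moreover have "(m, \<rho>) \<in> X \<times> {0..}" using m by simp
  ultimately show "\<exists>m\<in>X \<times> {0..}. \<forall>p\<in>X \<times> {0..}. (cone_dist \<theta> p m)\<^sup>2 \<le>
      (1 - t) * (cone_dist \<theta> p q)\<^sup>2 + t * (cone_dist \<theta> p w)\<^sup>2 - t * (1 - t) * (cone_dist \<theta> q w)\<^sup>2"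
    by blast
qed

end

text \<open>The cone over this metric is a star: one ray for each point of \<open>X\<close>, glued
  at the apex, with distance \<open>r + s\<close> between different rays. No angle lies strictly
  between \<open>0\<close> and \<open>pi\<close>, so the comparison is vacuous.\<close>

lemma angular_metric_discrete: "angular_metric X (\<lambda>x y. if x = y then 0 else pi)"
  by standard (auto split: if_splits)

text \<open>Rescaling preserves the CAT(0) inequality, and \<open>spherical_comparison\<close>
  converts it into the CAT(1) inequality with the same comparison point.\<close>

lemma (in pseudo_CAT0) angular_metric_truncated:
  assumes k: "0 \<le> k"
  shows "angular_metric P (\<lambda>x y. min (k * \<delta> x y) pi)"
proof
  show "min (k * \<delta> x z) pi \<le> min (k * \<delta> x y) pi + min (k * \<delta> y z) pi"
    if "x \<in> P" "y \<in> P" "z \<in> P" for x y z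
  proof -
    have "k * \<delta> x z \<le> k * (\<delta> x y + \<delta> y z)" using that k by (intro mult_left_mono triangle)
    moreover have "0 \<le> k * \<delta> x y" "0 \<le> k * \<delta> y z" using that k nonneg by simp_all
    ultimately show ?thesis using pi_gt_zero unfolding distrib_left by linarith
  qed
next
  fix y z and l :: real
  assume yz: "y \<in> P" "z \<in> P" and pos: "0 < min (k * \<delta> y z) pi" and "min (k * \<delta> y z) pi < pi"
    and l: "0 \<le> l" "l \<le> 1"
  then have small: "k * \<delta> y z < pi" "min (k * \<delta> y z) pi = k * \<delta> y z" by auto
  obtain m where m: "m \<in> P" and le: "\<And>x. x \<in> P \<Longrightarrow> (\<delta> x m)\<^sup>2 \<le>
      (1 - l) * (\<delta> x y)\<^sup>2 + l * (\<delta> x z)\<^sup>2 - l * (1 - l) * (\<delta> y z)\<^sup>2"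
    using comparison[OF yz l] by blast
  have "sin ((1 - l) * (k * \<delta> y z)) * cos (min (k * \<delta> x y) pi)
      + sin (l * (k * \<delta> y z)) * cos (min (k * \<delta> x z) pi)
      \<le> sin (k * \<delta> y z) * cos (min (k * \<delta> x m) pi)" if x: "x \<in> P" for x
  proof (rule spherical_comparison)
    have "k\<^sup>2 * (\<delta> x m)\<^sup>2 \<le> k\<^sup>2 * ((1 - l) * (\<delta> x y)\<^sup>2 + l * (\<delta> x z)\<^sup>2 - l * (1 - l) * (\<delta> y z)\<^sup>2)"
      by (rule mult_left_mono[OF le[OF x]]) simp
    then show "(k * \<delta> x m)\<^sup>2 \<le>
        (1 - l) * (k * \<delta> x y)\<^sup>2 + l * (k * \<delta> x z)\<^sup>2 - l * (1 - l) * (k * \<delta> y z)\<^sup>2"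
      by (simp add: power_mult_distrib algebra_simps)
    have tri: "k * \<delta> u w \<le> k * \<delta> u v + k * \<delta> v w" if "u \<in> P" "v \<in> P" "w \<in> P" for u v w
      using mult_left_mono[OF triangle[OF that] k] by (simp add: distrib_left)
    show "k * \<delta> x y \<le> k * \<delta> x z + k * \<delta> y z" using tri[OF x yz(2,1)] commute[OF yz] by simp
    show "k * \<delta> x z \<le> k * \<delta> x y + k * \<delta> y z" using tri[OF x yz] .
    show "k * \<delta> y z \<le> k * \<delta> x y + k * \<delta> x z" using tri[OF yz(1) x yz(2)] commute[OF yz(1) x] by simp
  qed (use x yz m k l pos small nonneg in auto)
  then show "\<exists>m\<in>P. \<forall>x\<in>P. sin ((1 - l) * min (k * \<delta> y z) pi) * cos (min (k * \<delta> x y) pi)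
      + sin (l * min (k * \<delta> y z) pi) * cos (min (k * \<delta> x z) pi)
      \<le> sin (min (k * \<delta> y z) pi) * cos (min (k * \<delta> x m) pi)"
    unfolding small(2) using m by blast
next
  fix x y assume xy: "x \<in> P" "y \<in> P"
  show "min (k * \<delta> x x) pi = 0" using zero[OF xy(1)] by simp
  show "0 \<le> min (k * \<delta> x y) pi" using nonneg[OF xy] k by simp
  show "min (k * \<delta> x y) pi \<le> pi" by simp
  show "min (k * \<delta> x y) pi = min (k * \<delta> y x) pi" using commute[OF xy] by simp
qed

section \<open>Squares of metric transforms\<close>

text \<open>For positive arguments this says that \<open>\<phi> x / x\<close> is nonincreasing. It
  makes the intercept of every chord of \<open>\<phi>\<close> nonnegative.\<close>

lemma metric_transform_scale:
  assumes "metric_transform \<phi>" "0 \<le> x" "x \<le> y"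
  shows "x * \<phi> y \<le> y * \<phi> x"
proof (cases "y = 0")
  case False
  have "concave_on {0..} \<phi>" "\<phi> 0 = 0" using assms by (auto simp: metric_transform_def)
  then have "(1 - x / y) * \<phi> 0 + x / y * \<phi> y \<le> \<phi> ((1 - x / y) *\<^sub>R 0 + (x / y) *\<^sub>R y)"
    using assms False by (intro concave_onD) auto
  then show ?thesis using \<open>\<phi> 0 = 0\<close> False assms by (simp add: field_simps)
qed (use assms in simp)

text \<open>On \<open>[x, y]\<close> the function \<open>\<phi>\<close> lies above its chord \<open>\<alpha> + \<beta> * t\<close>, where \<open>\<alpha>, \<beta> \<ge> 0\<close>, and
  \<open>(\<alpha> + \<beta> * sqrt u)\<^sup>2\<close> is concave in \<open>u\<close>.\<close>

lemma metric_transform_square_chord: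
  assumes \<phi>: "metric_transform \<phi>" and xy: "0 \<le> x" "x < y" and uv: "0 \<le> u" "0 \<le> v" "u + v = 1"
    and w: "0 \<le> w" "w\<^sup>2 = u * x\<^sup>2 + v * y\<^sup>2"
  shows "u * (\<phi> x)\<^sup>2 + v * (\<phi> y)\<^sup>2 \<le> (\<phi> w)\<^sup>2"
proof -
  have conc: "concave_on {0..} \<phi>" and mono: "\<phi> x \<le> \<phi> y"
    using \<phi> xy by (auto simp: metric_transform_def mono_on_def)
  define \<beta> where "\<beta> = (\<phi> y - \<phi> x) / (y - x)"
  define \<alpha> where "\<alpha> = \<phi> x - \<beta> * x"
  have \<beta>: "0 \<le> \<beta>" using mono xy by (simp add: \<beta>_def)
  have "\<alpha> = (y * \<phi> x - x * \<phi> y) / (y - x)" using xy by (simp add: \<alpha>_def \<beta>_def field_simps)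
  then have \<alpha>: "0 \<le> \<alpha>" using metric_transform_scale[OF \<phi>, of x y] xy by simp
  have ends: "\<phi> x = \<alpha> + \<beta> * x" "\<phi> y = \<alpha> + \<beta> * y" proof -
    show "\<phi> x = \<alpha> + \<beta> * x" by (simp add: \<alpha>_def)
    have "\<beta> * (y - x) = \<phi> y - \<phi> x" using xy by (simp add: \<beta>_def)
    then show "\<phi> y = \<alpha> + \<beta> * y" by (simp add: \<alpha>_def algebra_simps)
  qed
  have v: "v = 1 - u" using uv by simp
  have "x\<^sup>2 \<le> y\<^sup>2" using xy by (intro power_mono) auto
  then have "u * x\<^sup>2 \<le> u * y\<^sup>2" "v * x\<^sup>2 \<le> v * y\<^sup>2" using uv by (auto intro: mult_left_mono)
  then have "x\<^sup>2 \<le> w\<^sup>2" "w\<^sup>2 \<le> y\<^sup>2" unfolding w v by (auto simp: algebra_simps)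
  then have xwy: "x \<le> w" "w \<le> y" using xy w by (auto intro: power2_le_imp_le)
  define t where "t = (w - x) / (y - x)"
  have t: "0 \<le> t" "t \<le> 1" "(1 - t) * x + t * y = w"
  proof -
    show "0 \<le> t" "t \<le> 1" using xwy xy by (auto simp: t_def)
    have "t * (y - x) = w - x" using xy by (simp add: t_def)
    then show "(1 - t) * x + t * y = w" by (simp add: algebra_simps)
  qed
  have "(1 - t) * \<phi> x + t * \<phi> y \<le> \<phi> w"
    using concave_onD[OF conc t(1,2), of x y] xy t(3) by simp
  moreover have "(1 - t) * \<phi> x + t * \<phi> y = \<alpha> + \<beta> * w"
    unfolding ends t(3)[symmetric] by (simp add: algebra_simps)
  ultimately have chord: "\<alpha> + \<beta> * w \<le> \<phi> w" by simp
  \<comment> \<open>\<open>w\<close> is the quadratic mean of \<open>x\<close> and \<open>y\<close>,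
    hence at least their arithmetic mean. Only the cross term \<open>2 * \<alpha> * \<beta>\<close>
    needs this; the other terms of the squares agree.\<close>
  have "(u * x + v * y)\<^sup>2 \<le> w\<^sup>2"
  proof -
    have "w\<^sup>2 - (u * x + v * y)\<^sup>2 = u * v * (x - y)\<^sup>2" unfolding w v by algebra
    moreover have "0 \<le> u * v * (x - y)\<^sup>2" using uv by simp
    ultimately show ?thesis by linarith
  qed
  then have "u * x + v * y \<le> w" using w by (auto intro: power2_le_imp_le)
  then have "2 * \<alpha> * \<beta> * (u * x + v * y) \<le> 2 * \<alpha> * \<beta> * w"
    using \<alpha> \<beta> by (intro mult_left_mono) auto
  moreover have "u * (\<phi> x)\<^sup>2 + v * (\<phi> y)\<^sup>2 = \<alpha>\<^sup>2 + 2 * \<alpha> * \<beta> * (u * x + v * y) + \<beta>\<^sup>2 * w\<^sup>2"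
    unfolding ends w v by algebra
  moreover have "(\<alpha> + \<beta> * w)\<^sup>2 = \<alpha>\<^sup>2 + 2 * \<alpha> * \<beta> * w + \<beta>\<^sup>2 * w\<^sup>2" by algebra
  moreover have "(\<alpha> + \<beta> * w)\<^sup>2 \<le> (\<phi> w)\<^sup>2"
    using chord \<alpha> \<beta> w by (intro power_mono) auto
  ultimately show ?thesis by linarith
qed

lemma concave_on_metric_transform_square:
  assumes \<phi>: "metric_transform \<phi>"
  shows "concave_on {0..} (\<lambda>u. (\<phi> (sqrt u))\<^sup>2)"
  unfolding concave_on_iff
proof (intro conjI ballI allI impI)
  fix X Y u v :: real assume XY: "X \<in> {0..}" "Y \<in> {0..}" and uv: "0 \<le> u" "0 \<le> v" "u + v = 1"
  define w where "w = sqrt (u * X + v * Y)"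
  have w: "0 \<le> w" "w\<^sup>2 = u * (sqrt X)\<^sup>2 + v * (sqrt Y)\<^sup>2" using XY uv by (auto simp: w_def)
  consider "sqrt X < sqrt Y" | "sqrt Y < sqrt X" | "X = Y" by fastforce
  then have "u * (\<phi> (sqrt X))\<^sup>2 + v * (\<phi> (sqrt Y))\<^sup>2 \<le> (\<phi> w)\<^sup>2"
  proof cases
    case 1
    then show ?thesis using XY uv w by (intro metric_transform_square_chord[OF \<phi>]) auto
  next
    case 2
    then have "v * (\<phi> (sqrt Y))\<^sup>2 + u * (\<phi> (sqrt X))\<^sup>2 \<le> (\<phi> w)\<^sup>2"
      using XY uv w by (intro metric_transform_square_chord[OF \<phi>]) auto
    then show ?thesis by simp
  next
    case 3
    then have "u * X + v * Y = X" using uv by (simp flip: distrib_right)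
    then show ?thesis using 3 uv by (simp add: w_def flip: distrib_right)
  qed
  then show "u * (\<phi> (sqrt X))\<^sup>2 + v * (\<phi> (sqrt Y))\<^sup>2 \<le> (\<phi> (sqrt (u *\<^sub>R X + v *\<^sub>R Y)))\<^sup>2"
    by (simp add: w_def)
qed simp

section \<open>Interpolation at the powers of 4\<close>

lemma nonneg_antimono_int_limit:
  fixes m :: "int \<Rightarrow> real"
  assumes step: "\<And>n. m (n + 1) \<le> m n" and nonneg: "\<And>n. 0 \<le> m n"
  obtains c where "0 \<le> c" "\<And>N. (\<lambda>k. m (N + int k)) \<longlonglongrightarrow> c"
proof -
  have mono: "m n' \<le> m n" if "n \<le> n'" for n n'
    using that by (induction n' rule: int_ge_induct) (use step order_trans in blast)+
  define c where "c = (INF n. m n)"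
  have bdd: "bdd_below (range m)" using nonneg by (auto intro: bdd_belowI[where m = 0])
  have "(\<lambda>k. m (N + int k)) \<longlonglongrightarrow> c" for N
  proof (rule order_tendstoI)
    fix a assume "a < c"
    moreover have "c \<le> m n" for n unfolding c_def using bdd by (rule cINF_lower) simp
    ultimately have "a < m (N + int k)" for k by (rule less_le_trans)
    then show "\<forall>\<^sub>F k in sequentially. a < m (N + int k)" by simp
  next
    fix a assume "c < a"
    then obtain n where n: "m n < a" using bdd by (auto simp: c_def cINF_less_iff)
    have "m (N + int k) < a" if "nat (n - N) \<le> k" for k
      using mono[of n "N + int k"] n that by linarith
    then show "\<forall>\<^sub>F k in sequentially. m (N + int k) < a"
      by (auto simp: eventually_sequentially)
  qed
  moreover have "0 \<le> c" unfolding c_def using nonneg by (intro cINF_greatest) auto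
  ultimately show thesis using that by blast
qed

text \<open>The line through the graph points over \<open>4 powi n\<close> and \<open>4 powi (n + 1)\<close> has slope \<open>m n\<close> and
  intercept \<open>e n\<close>. The coefficients are \<open>a n = m (n - 1) - m n\<close>, for which both
  \<open>\<Sum> a n\<close> and \<open>\<Sum> a n * 4 powi n\<close> telescope.\<close>

lemma concave_dyadic_decomposition:
  fixes f :: "real \<Rightarrow> real"
  assumes conc: "concave_on {0..} f" and mono: "mono_on {0..} f" and f0: "f 0 = 0"
  obtains c j :: real and a :: "int \<Rightarrow> real" where "0 \<le> c" "0 \<le> j" "\<And>n. 0 \<le> a n"
    "\<And>u. 0 < u \<Longrightarrow> \<exists>g. ((\<lambda>n. a n * min u (4 powi n)) has_sum (g - c * u - j)) UNIV
      \<and> g \<le> f u \<and> f u \<le> 4 * g"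
proof -
  define U :: "int \<Rightarrow> real" where "U n = 4 powi n" for n
  have U0: "0 < U n" for n by (simp add: U_def)
  have U4: "U (n + 1) = 4 * U n" for n by (simp add: U_def power_int_add)
  have U_mono: "U n \<le> U n'" if "n \<le> n'" for n n' using that by (simp add: U_def power_int_increasing)
  define m where "m n = (f (U (n + 1)) - f (U n)) / (3 * U n)" for n
  define e where "e n = f (U n) - m n * U n" for n
  have m_eq: "m n * U n = (f (4 * U n) - f (U n)) / 3" for n
    using U0[of n] by (simp add: m_def U4)
  have le4: "f (4 * u) \<le> 4 * f u" if "0 \<le> u" for u
    using concave_onD[OF conc, of "1/4" 0 "4 * u"] that f0 by simp
  have fmono: "f u \<le> f v" if "0 \<le> u" "u \<le> v" for u v
    using mono that by (auto simp: mono_on_def)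
  have m0: "0 \<le> m n" for n
    using fmono[of "U n" "U (n + 1)"] U0[of n] by (simp add: m_def U4)
  have e0: "0 \<le> e n" for n
    using le4[of "U n"] U0[of n] m_eq[of n] by (simp add: e_def)
  have m_step: "m (n + 1) \<le> m n" for n
  proof -
    \<comment> \<open>\<open>4 * U n\<close> divides the interval from \<open>U n\<close> to
      \<open>16 * U n\<close> in the ratio 3 : 12, whence the weight \<open>1/5\<close>.\<close>
    have eq: "(1 - 1/5) * U n + 1/5 * (16 * U n) = 4 * U n" by simp
    have "(1 - 1/5) * f (U n) + 1/5 * f (16 * U n) \<le> f (4 * U n)"
      using concave_onD[OF conc, of "1/5" "U n" "16 * U n"] U0[of n] unfolding real_scaleR_def eq by simp
    then have "4 * U n * m (n + 1) \<le> 4 * U n * m n"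
      using m_eq[of n] m_eq[of "n + 1"] by (simp add: U4 mult.commute)
    then show ?thesis using U0[of n] by simp
  qed
  define a where "a n = m (n - 1) - m n" for n
  have a0: "0 \<le> a n" for n using m_step[of "n - 1"] by (simp add: a_def)
  have aU: "a n * U n = e n - e (n - 1)" for n
  proof -
    have "U n = 4 * U (n - 1)" using U4[of "n - 1"] by simp
    then show ?thesis using m_eq[of "n - 1"] by (simp add: a_def e_def algebra_simps)
  qed
  \<comment> \<open>The slopes decrease to \<open>c\<close> as \<open>n\<close> tends to infinity,
    the intercepts to \<open>j\<close> as \<open>n\<close> tends to minus infinity. These limits are
    what telescoping leaves over: the linear term and the jump.\<close>
  obtain c where c: "0 \<le> c" "\<And>N. (\<lambda>k. m (N + int k)) \<longlonglongrightarrow> c"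
    using nonneg_antimono_int_limit[of m] m_step m0 by blast
  have "e (- (n + 1)) \<le> e (- n)" for n
    using aU[of "- n"] a0[of "- n"] U0[of "- n"] mult_nonneg_nonneg[of "a (- n)" "U (- n)"] by simp
  then obtain j where j: "0 \<le> j" "\<And>N. (\<lambda>k. e (- (N + int k))) \<longlonglongrightarrow> j"
    using nonneg_antimono_int_limit[of "\<lambda>n. e (- n)"] e0 by blast
  have "\<exists>g. ((\<lambda>n. a n * min u (U n)) has_sum (g - c * u - j)) UNIV \<and> g \<le> f u \<and> f u \<le> 4 * g"
    if u: "0 < u" for u
  proof -
    \<comment> \<open>\<open>min u (U n)\<close> is \<open>u\<close> for \<open>n > N\<close> and
      \<open>U n\<close> for \<open>n \<le> N\<close>. The two halves telescope to
      \<open>u * (m N - c)\<close> and \<open>e N - j\<close>; with \<open>c * u + j\<close> they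
      give \<open>m N * u + e N\<close>, the interpolating line on
      \<open>[U N, U (N + 1)]\<close>.\<close>
    define N where "N = \<lfloor>log 4 u\<rfloor>"
    have N: "U N \<le> u" "u \<le> U (N + 1)"
    proof -
      have pw: "U n = 4 powr of_int n" for n by (simp add: U_def powr_real_of_int')
      have "of_int N \<le> log 4 u" "log 4 u \<le> of_int (N + 1)" by (simp_all add: N_def)
      then show "U N \<le> u" "u \<le> U (N + 1)" unfolding pw using u by (simp_all add: le_log_iff log_le_iff)
    qed
    have "((\<lambda>n. a n * min u (U n)) has_sum (u * (m N - c))) {N<..}"
    proof -
      have "(\<lambda>k. m (N + int k) - m (N + int (Suc k))) sums (m N - c)"
        using telescope_sums'[OF c(2)[of N]] by simp
      then have "(\<lambda>k. u * a (N + 1 + int k)) sums (u * (m N - c))"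
        by (intro sums_mult) (simp add: a_def algebra_simps)
      then have "((\<lambda>k. u * a (N + 1 + int k)) has_sum (u * (m N - c))) UNIV"
        using u a0 by (intro sums_nonneg_imp_has_sum) auto
      moreover have "min u (U (N + 1 + int k)) = u" for k
        using N U_mono[of "N + 1" "N + 1 + int k"] by simp
      ultimately have "((\<lambda>k. a (N + 1 + int k) * min u (U (N + 1 + int k))) has_sum (u * (m N - c))) UNIV"
        by (simp add: mult.commute)
      moreover have "bij_betw (\<lambda>k. N + 1 + int k) UNIV {N<..}"
        by (rule bij_betwI[where g = "\<lambda>n. nat (n - N - 1)"]) auto
      ultimately show ?thesis
        using has_sum_reindex_bij_betw[of "\<lambda>k. N + 1 + int k" UNIV "{N<..}" "\<lambda>n. a n * min u (U n)"]
        by simp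
    qed
    moreover have "((\<lambda>n. a n * min u (U n)) has_sum (e N - j)) {..N}"
    proof -
      have "(\<lambda>k. e (- (- N + int k)) - e (- (- N + int (Suc k)))) sums (e N - j)"
        using telescope_sums'[OF j(2)[of "- N"]] by simp
      then have "(\<lambda>k. a (N - int k) * U (N - int k)) sums (e N - j)"
        by (simp only: aU) (simp add: algebra_simps)
      then have "((\<lambda>k. a (N - int k) * U (N - int k)) has_sum (e N - j)) UNIV"
        using U0 a0 by (intro sums_nonneg_imp_has_sum) (auto simp: less_imp_le)
      moreover have "min u (U (N - int k)) = U (N - int k)" for k
        using N U_mono[of "N - int k" N] by simp
      ultimately have "((\<lambda>k. a (N - int k) * min u (U (N - int k))) has_sum (e N - j)) UNIV"
        by simp
      moreover have "bij_betw (\<lambda>k. N - int k) UNIV {..N}"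
        by (rule bij_betwI[where g = "\<lambda>n. nat (N - n)"]) auto
      ultimately show ?thesis
        using has_sum_reindex_bij_betw[of "\<lambda>k. N - int k" UNIV "{..N}" "\<lambda>n. a n * min u (U n)"]
        by simp
    qed
    ultimately have "((\<lambda>n. a n * min u (U n)) has_sum (u * (m N - c) + (e N - j))) ({N<..} \<union> {..N})"
      by (rule has_sum_Un_disjoint) auto
    moreover have "{N<..} \<union> {..N} = UNIV" by auto
    moreover define g where "g = e N + m N * u"
    ultimately have sum: "((\<lambda>n. a n * min u (U n)) has_sum (g - c * u - j)) UNIV"
      by (simp add: algebra_simps)
    have "g \<le> f u"
    proof -
      define l where "l = (u - U N) / (3 * U N)"
      have l: "l * (3 * U N) = u - U N" "0 \<le> l" "l \<le> 1"
        using N[unfolded U4] U0[of N] by (simp_all add: l_def pos_divide_le_eq)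
      have eq: "(1 - l) * U N + l * (4 * U N) = u" using l(1) by (simp add: algebra_simps)
      have "(1 - l) * f (U N) + l * f (4 * U N) \<le> f u"
        using concave_onD[OF conc l(2,3), of "U N" "4 * U N"] U0[of N] unfolding real_scaleR_def eq by simp
      moreover have "g = (1 - l) * f (U N) + l * f (4 * U N)"
      proof -
        have "g = f (U N) + m N * (u - U N)" by (simp add: g_def e_def algebra_simps)
        also have "\<dots> = f (U N) + 3 * l * (m N * U N)" unfolding l(1)[symmetric] by (simp add: algebra_simps)
        also have "\<dots> = (1 - l) * f (U N) + l * f (4 * U N)"
          unfolding m_eq by (simp add: field_simps)
        finally show ?thesis .
      qed
      ultimately show ?thesis by simp
    qed
    \<comment> \<open>The line is nondecreasing, so \<open>g\<close> is at least
      \<open>f (U N)\<close>, while \<open>f\<close> grows at most by the factor 4 over one step.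
      This is the only loss in the decomposition; it becomes 2 for distances.\<close>
    moreover have "f u \<le> 4 * g"
    proof -
      have "f u \<le> f (4 * U N)" using N(2)[unfolded U4] u by (intro fmono) auto
      also have "\<dots> \<le> 4 * f (U N)" using U0[of N] by (intro le4) simp
      also have "f (U N) \<le> g" using m0[of N] N by (simp add: g_def e_def mult_left_mono)
      finally show ?thesis by simp
    qed
    ultimately show ?thesis using sum by blast
  qed
  then show thesis unfolding U_def by (rule that[OF c(1) j(1) a0])
qed

section \<open>The embedding\<close>

lemma jordan_sin_ge:
  fixes \<mu> :: real assumes "0 \<le> \<mu>" "\<mu> \<le> 1" shows "\<mu> \<le> sin (pi / 2 * \<mu>)"
proof -
  have "concave_on {0..pi/2} sin"
    by (rule f''_le0_imp_concave[where f' = cos and f'' = "\<lambda>x. - sin x"])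
      (auto intro!: derivative_eq_intros sin_ge_zero)
  from concave_onD[OF this assms, of 0 "pi/2"] show ?thesis by (simp add: mult.commute)
qed

text \<open>Points of equal radius \<open>\<rho>\<close> have squared distance
  \<open>(2 * \<rho> * sin (\<theta> / 2))\<^sup>2\<close>. The radius makes this
  \<open>a * R\<^sup>2\<close> at \<open>\<theta> = pi\<close>, exactly where the truncation sets
  in; below that the bounds come from \<open>2 / pi * x \<le> sin x \<le> x\<close>.\<close>

lemma cone_profile_bounds:
  fixes a t R :: real
  assumes a: "0 \<le> a" and t: "0 \<le> t" and R: "0 < R"
  defines "\<rho> \<equiv> sqrt a * R / 2" and "\<theta> \<equiv> min (pi / R * t) pi"
  shows "a * min (t\<^sup>2) (R\<^sup>2) \<le> \<rho>\<^sup>2 + \<rho>\<^sup>2 - 2 * \<rho> * \<rho> * cos \<theta>"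
    and "\<rho>\<^sup>2 + \<rho>\<^sup>2 - 2 * \<rho> * \<rho> * cos \<theta> \<le> pi\<^sup>2 / 4 * (a * min (t\<^sup>2) (R\<^sup>2))"
proof -
  define \<mu> where "\<mu> = min (t / R) 1"
  have \<mu>: "0 \<le> \<mu>" "\<mu> \<le> 1" using t R by (auto simp: \<mu>_def)
  have "\<theta> = 2 * (pi / 2 * \<mu>)" using R by (auto simp: \<theta>_def \<mu>_def min_def field_simps)
  then have "cos \<theta> = 1 - 2 * (sin (pi / 2 * \<mu>))\<^sup>2" by (simp only: cos_double_sin)
  moreover have "4 * \<rho>\<^sup>2 = a * R\<^sup>2" using a by (simp add: \<rho>_def power_mult_distrib power_divide)
  ultimately have eq: "\<rho>\<^sup>2 + \<rho>\<^sup>2 - 2 * \<rho> * \<rho> * cos \<theta> = a * R\<^sup>2 * (sin (pi / 2 * \<mu>))\<^sup>2"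
    by algebra
  have min: "min (t\<^sup>2) (R\<^sup>2) = R\<^sup>2 * \<mu>\<^sup>2"
  proof (cases "t \<le> R")
    case True
    then have "t\<^sup>2 \<le> R\<^sup>2" using t by (intro power_mono)
    then show ?thesis using True R by (simp add: \<mu>_def min_def power_divide)
  next
    case False
    then have "R\<^sup>2 \<le> t\<^sup>2" using R by (intro power_mono) auto
    then show ?thesis using False R by (simp add: \<mu>_def min_def)
  qed
  have "\<mu>\<^sup>2 \<le> (sin (pi / 2 * \<mu>))\<^sup>2" using jordan_sin_ge[OF \<mu>] \<mu> by (intro power_mono)
  then show "a * min (t\<^sup>2) (R\<^sup>2) \<le> \<rho>\<^sup>2 + \<rho>\<^sup>2 - 2 * \<rho> * \<rho> * cos \<theta>"
    unfolding eq min using a by (simp add: mult.assoc mult_left_mono)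
  have "(sin (pi / 2 * \<mu>))\<^sup>2 \<le> (pi / 2 * \<mu>)\<^sup>2"
    using \<mu> by (intro power_mono sin_x_le_x sin_ge_zero) (auto simp: mult_left_le)
  then have "(a * R\<^sup>2) * (sin (pi / 2 * \<mu>))\<^sup>2 \<le> (a * R\<^sup>2) * (pi / 2 * \<mu>)\<^sup>2"
    using a by (intro mult_left_mono) auto
  then show "\<rho>\<^sup>2 + \<rho>\<^sup>2 - 2 * \<rho> * \<rho> * cos \<theta> \<le> pi\<^sup>2 / 4 * (a * min (t\<^sup>2) (R\<^sup>2))"
    unfolding eq min by (simp add: power_mult_distrib power_divide algebra_simps)
qed

lemma CAT0_empty: "CAT0 {} (\<lambda>_ _. 0)"
  by (simp add: CAT0_def Metric_space_def)

lemma metric_transform_embeds_pi: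
  fixes \<phi> :: "real \<Rightarrow> real" and X :: "'a set" and d :: "'a \<Rightarrow> 'a \<Rightarrow> real"
  assumes \<phi>: "metric_transform \<phi>" and "CAT0 X d"
  shows "embeds_into_some_CAT0 X (\<lambda>x y. \<phi> (d x y)) pi"
proof (cases "X = {}")
  case True
  then show ?thesis using CAT0_empty
    unfolding embeds_into_some_CAT0_def embedding_distortion_le_def by (auto intro: exI[of _ 1])
next
  case False
  then obtain b where b: "b \<in> X" by blast
  interpret X: Metric_space X d using assms(2) by (simp add: CAT0_def)
  interpret pX: pseudo_CAT0 X d using CAT0_imp_pseudo_CAT0[OF assms(2)] .
  have mono: "mono_on {0..} \<phi>" and pos: "0 \<le> t \<Longrightarrow> 0 \<le> \<phi> t" and \<phi>0: "\<phi> 0 = 0" for t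
    using \<phi> by (auto simp: metric_transform_def)
  have "mono_on {0..} (\<lambda>u. (\<phi> (sqrt u))\<^sup>2)"
    using mono pos by (auto simp: mono_on_def intro!: power_mono)
  then obtain c j :: real and a :: "int \<Rightarrow> real" where cj: "0 \<le> c" "0 \<le> j" "\<And>n. 0 \<le> a n"
    and sum: "\<And>u. 0 < u \<Longrightarrow> \<exists>g. ((\<lambda>n. a n * min u (4 powi n)) has_sum (g - c * u - j)) UNIV
      \<and> g \<le> (\<phi> (sqrt u))\<^sup>2 \<and> (\<phi> (sqrt u))\<^sup>2 \<le> 4 * g"
    using concave_dyadic_decomposition[OF concave_on_metric_transform_square[OF \<phi>]] \<phi>0
    by (smt (verit) real_sqrt_zero power_zero_numeral)
  \<comment> \<open>\<open>int_decode\<close> enumerates the integers; the squares of these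
    truncation radii are the nodes \<open>4 powi n\<close>.\<close>
  define R :: "nat \<Rightarrow> real" where "R k = 2 powi int_decode k" for k
  have R: "0 < R k" "(R k)\<^sup>2 = 4 powi int_decode k" for k
    by (simp_all add: R_def power2_eq_square flip: power_int_mult_distrib)
  \<comment> \<open>Index 0 is \<open>X\<close>, paired with a real coordinate that its distance
    ignores so that all factors share one type; index 1 is the star, index \<open>k + 2\<close> the
    cone for truncation at \<open>R k\<close>.\<close>
  define P where "P = case_nat (X \<times> UNIV) (\<lambda>_. X \<times> {0::real..})"
  define \<delta> where "\<delta> = case_nat (\<lambda>p q. sqrt c * d (fst p) (fst q))
    (case_nat (cone_dist (\<lambda>x y. if x = y then 0 else pi))
      (\<lambda>k. cone_dist (\<lambda>x y. min (pi / R k * d x y) pi)))"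
  \<comment> \<open>Points of radius \<open>\<rho>\<close> at angle \<open>pi\<close> have distance
    \<open>2 * \<rho>\<close>: \<open>sqrt j\<close> for any two different rays of the star, and
    \<open>sqrt (a n) * R k\<close> in the cone with \<open>n = int_decode k\<close>. At index 0 the
    value is a placeholder.\<close>
  define \<rho> where "\<rho> = case_nat 0 (case_nat (sqrt j / 2) (\<lambda>k. sqrt (a (int_decode k)) * R k / 2))"
  define F where "F x n = (x, \<rho> n)" for x :: 'a and n
  have comp: "pseudo_CAT0 (P n) (\<delta> n)" for n
  proof -
    consider "n = 0" | "n = Suc 0" | k where "n = Suc (Suc k)" by (metis not0_implies_Suc)
    then show ?thesis
    proof cases
      case 1
      have "fst ` (X \<times> (UNIV :: real set)) = X" by auto
      then show ?thesis
        unfolding 1 P_def \<delta>_def using cj(1) by (simp add: pX.scaled_pullback)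
    next
      case 2
      show ?thesis unfolding 2 P_def \<delta>_def
        using angular_metric.pseudo_CAT0_cone[OF angular_metric_discrete] by simp
    next
      case 3
      show ?thesis unfolding 3 P_def \<delta>_def
        using angular_metric.pseudo_CAT0_cone[OF pX.angular_metric_truncated, of "pi / R k"] R(1)[of k]
        by simp
    qed
  qed
  have FP: "F x n \<in> P n" if "x \<in> X" for x n
    using that cj R(1) by (auto simp: F_def P_def \<rho>_def less_imp_le split: nat.split)
  have same: "\<delta> n (F x n) (F x n) = 0" if "x \<in> X" for x n
    using pseudo_CAT0.zero[OF comp FP[OF that]] .
  have bounds: "summable (\<lambda>n. (\<delta> n (F x n) (F y n))\<^sup>2) \<and>
      (\<phi> (d x y))\<^sup>2 \<le> 4 * (\<Sum>n. (\<delta> n (F x n) (F y n))\<^sup>2) \<and>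
      4 * (\<Sum>n. (\<delta> n (F x n) (F y n))\<^sup>2) \<le> pi\<^sup>2 * (\<phi> (d x y))\<^sup>2"
    if xy: "x \<in> X" "y \<in> X" for x y
  proof (cases "x = y")
    case True
    then show ?thesis using same[OF xy(1)] X.zero[OF xy] \<phi>0 by simp
  next
    case False
    define t where "t = d x y"
    have t: "0 < t" using False X.zero[OF xy] X.nonneg[of x y] by (auto simp: t_def less_le)
    then obtain g where g: "((\<lambda>n. a n * min (t\<^sup>2) (4 powi n)) has_sum (g - c * t\<^sup>2 - j)) UNIV"
        "g \<le> (\<phi> t)\<^sup>2" "(\<phi> t)\<^sup>2 \<le> 4 * g"
      using sum[of "t\<^sup>2"] by auto
    \<comment> \<open>The squared distances wanted from the individual factors, with sum
      \<open>g\<close>. Factors 0 and 1 attain them exactly, the cones up to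
      \<open>pi\<^sup>2 / 4\<close>.\<close>
    define \<tau> where "\<tau> = case_nat (c * t\<^sup>2)
      (case_nat j (\<lambda>k. a (int_decode k) * min (t\<^sup>2) ((R k)\<^sup>2)))"
    have "((\<lambda>k. a (int_decode k) * min (t\<^sup>2) ((R k)\<^sup>2)) has_sum (g - c * t\<^sup>2 - j)) UNIV"
      unfolding R(2) 
      using g(1) has_sum_reindex_bij_betw[OF bij_int_decode, of "\<lambda>n. a n * min (t\<^sup>2) (4 powi n)"]
      by blast
    then have "(\<lambda>k. \<tau> (Suc (Suc k))) sums (g - c * t\<^sup>2 - j)"
      by (simp add: \<tau>_def has_sum_imp_sums)
    from sums_Suc[OF sums_Suc[OF this]] have \<tau>: "\<tau> sums g" by (simp add: \<tau>_def)
    have le_\<tau>: "\<tau> n \<le> (\<delta> n (F x n) (F y n))\<^sup>2 \<and> (\<delta> n (F x n) (F y n))\<^sup>2 \<le> pi\<^sup>2 / 4 * \<tau> n" for n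
    proof -
      have pi4: "z \<le> pi\<^sup>2 / 4 * z" if "0 \<le> z" for z :: real
      proof -
        have "(2::real)\<^sup>2 \<le> pi\<^sup>2" using pi_ge_two by (intro power_mono) auto
        then show ?thesis using that mult_right_mono[of 1 "pi\<^sup>2 / 4" z] by simp
      qed
      consider "n = 0" | "n = Suc 0" | k where "n = Suc (Suc k)" by (metis not0_implies_Suc)
      then show ?thesis
      proof cases
        case 1
        then show ?thesis using cj(1) pi4[of "c * t\<^sup>2"]
          by (simp add: \<delta>_def \<tau>_def F_def power_mult_distrib t_def)
      next
        case 2
        then show ?thesis using cj(2) pi4[of j] False
          by (simp add: \<delta>_def \<tau>_def F_def \<rho>_def cone_dist_square power_divide flip: power2_eq_square)
      next
        case 3
        show ?thesis unfolding 3
          using cone_profile_bounds[OF cj(3)[of "int_decode k"] less_imp_le[OF t] R(1)[of k]]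
          by (simp add: \<delta>_def \<tau>_def F_def \<rho>_def cone_dist_square t_def)
      qed
    qed
    have sm: "summable (\<lambda>n. (\<delta> n (F x n) (F y n))\<^sup>2)"
      by (rule summable_comparison_test'[OF summable_mult[OF sums_summable[OF \<tau>], of "pi\<^sup>2 / 4"], of 0])
        (use le_\<tau> in simp)
    have "g \<le> (\<Sum>n. (\<delta> n (F x n) (F y n))\<^sup>2)"
      using sums_le[OF _ \<tau> summable_sums[OF sm]] le_\<tau> by blast
    moreover have "(\<Sum>n. (\<delta> n (F x n) (F y n))\<^sup>2) \<le> pi\<^sup>2 / 4 * g"
      using sums_le[OF _ summable_sums[OF sm] sums_mult[OF \<tau>, of "pi\<^sup>2 / 4"]] le_\<tau> by blast
    moreover have "pi\<^sup>2 * g \<le> pi\<^sup>2 * (\<phi> t)\<^sup>2" using g(2) by (intro mult_left_mono) auto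
    ultimately show ?thesis using sm g(3) unfolding t_def by (intro conjI; (assumption | linarith))
  qed
  define Q where "Q = l2_carrier P \<delta> (F b)"
  interpret Q: pseudo_CAT0 Q "l2_dist \<delta>"
    unfolding Q_def using comp FP[OF b] by (rule pseudo_CAT0_l2_product)
  have FQ: "F x \<in> Q" if "x \<in> X" for x
    using that FP bounds[OF b that] by (simp add: Q_def l2_carrier_def)
  obtain Y :: "'a target_point set" and dY rep where Y: "CAT0 Y dY" and rep: "rep \<in> Q \<rightarrow> Y"
    and dY: "\<And>x y. x \<in> Q \<Longrightarrow> y \<in> Q \<Longrightarrow> dY (rep x) (rep y) = l2_dist \<delta> x y"
    using Q.CAT0_quotient by blast
  \<comment> \<open>The scale 2 absorbs the factor 4 between \<open>\<phi>\<^sup>2\<close> and the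
    sum of squares; the upper bound is then \<open>2 * (pi / 2)\<close>.\<close>
  have "\<phi> (d x y) \<le> 2 * dY (rep (F x)) (rep (F y)) \<and>
      2 * dY (rep (F x)) (rep (F y)) \<le> pi * \<phi> (d x y)" if xy: "x \<in> X" "y \<in> X" for x y
  proof -
    let ?S = "\<Sum>n. (\<delta> n (F x n) (F y n))\<^sup>2"
    have S: "2 * dY (rep (F x)) (rep (F y)) = sqrt (4 * ?S)"
      using dY FQ xy by (simp add: l2_dist_def real_sqrt_mult)
    have "0 \<le> \<phi> (d x y)" using pos X.nonneg by blast
    then show ?thesis
      unfolding S using bounds[OF xy]
      by (auto intro!: real_le_rsqrt real_le_lsqrt simp: power_mult_distrib)
  qed
  then have "embedding_distortion_le X (\<lambda>x y. \<phi> (d x y)) Y dY (\<lambda>x. rep (F x)) pi"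
    unfolding embedding_distortion_le_def using rep FQ by (auto intro!: exI[of _ 2])
  then show ?thesis using Y unfolding embeds_into_some_CAT0_def by blast
qed

theorem theorem1p1:
  fixes \<phi> :: "real \<Rightarrow> real" and X :: "'a set" and d :: "'a \<Rightarrow> 'a \<Rightarrow> real"
  assumes "metric_transform \<phi>" and "CAT0 X d"
  shows "embeds_into_some_CAT0 X (\<lambda>x y. \<phi> (d x y)) (pi * sqrt (3/2)) \<and> pi * sqrt (3/2) < 4"
proof
  have D: "pi \<le> pi * sqrt (3/2)" using pi_gt_zero by simp
  have "pi * \<phi> (d x y) \<le> pi * sqrt (3/2) * \<phi> (d x y)" for x y
  proof -
    have "0 \<le> d x y" using assms(2) by (simp add: CAT0_def Metric_space_def)
    then have "0 \<le> \<phi> (d x y)" using assms(1) by (auto simp: metric_transform_def)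
    then show ?thesis by (rule mult_right_mono[OF D])
  qed
  then show "embeds_into_some_CAT0 X (\<lambda>x y. \<phi> (d x y)) (pi * sqrt (3/2))"
    using metric_transform_embeds_pi[OF assms]
    unfolding embeds_into_some_CAT0_def embedding_distortion_le_def by (meson order_trans)
  \<comment> \<open>The rough bound 3.2 suffices, since
    \<open>3.2\<^sup>2 * (3/2) = 15.36\<close>.\<close>
  have "pi\<^sup>2 \<le> (3.2)\<^sup>2" using pi_approx by (intro power_mono) auto
  then have "pi\<^sup>2 * (3/2) < 4\<^sup>2" by (simp add: power2_eq_square)
  then have "sqrt (pi\<^sup>2 * (3/2)) < 4" by (intro real_less_lsqrt) auto
  then show "pi * sqrt (3/2) < 4" by (simp only: real_sqrt_mult real_sqrt_pow2_iff real_sqrt_abs) simp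
qed

end
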